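(* Let $(X_n)_{n\ge0}$ be Markov chains on $(\mathbb S_n)_{n\ge0}$ with rates $(c_n)$ and down-operators $(D_n)$ satisfying (A0)--(A5) of the context, and let $E,\iota,(d^o_s)_{s\in\mathbb S}$ satisfy (L1)--(L3) of the context. Suppose that $c_n\to\infty$ and that $(\varepsilon_n)_{n\ge0}$ is a positive sequence converging to zero with $\varepsilon_nc_n\to1$. For $f_n\in C(\mathbb S_n)$ and $f\in C(E)$, $f_n\to f$ means $\|f_n-\pi_nf\|_{C(\mathbb S_n)}\to0$, where $\pi_nf=f\circ\iota|_{\mathbb S_n}$. Then: (i) for every $f\in C(E)$ and $t\ge0$ the limit $\mathcal T(t)f=\lim_{n\to\infty}T_n^{\lfloor t/\varepsilon_n\rfloor}\pi_nf$ exists in $C(E)$, in the sense that $\|T_n^{\lfloor t/\varepsilon_n\rfloor}\pi_nf-\pi_n\mathcal T(t)f\|_{C(\mathbb S_n)}\to0$ as $n\to\infty$, and defines a family of linear operators; (ii) these operators satisfy $\mathcal T(t)f^o=(Q_tf)^o$ for all $f\in H$, or equivalently $\mathcal T(t)h^o_s=e^{-tc_{|s|-1}}h^o_s$ for $s\in\mathbb S$, $t\ge0$; (iii) these operators form a Feller semigroup on $C(E)$; (iv) $\mathcal H=\operatorname{span}\{d^o_s\}_{s\in\mathbb S}$ is a core for the generator $\mathcal A$ of this semigroup, and the action of $\mathcal A$ on $\mathcal H$ is given by $\mathcal Ah^o_s=-c_{|s|-1}h^o_s$, $s\in\mathbb S$; (v) $A_n(f)_n\to\mathcal Af^o$ as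 $n\to\infty$, in the sense that $\|A_n(f)_n-\pi_n\mathcal Af^o\|_{C(\mathbb S_n)}\to0$, for every $f\in H$.
   Context: $C(Z)$: continuous real functions on $Z$ with the sup norm (all functions if $Z$ finite). A transition operator from $C(Z')$ to $C(Z)$ ($Z,Z'$ finite) is a map $f\mapsto\sum_{y\in Z'}\mu(\cdot,y)f(y)$ with $\mu$ a stochastic $Z\times Z'$ matrix. $\mathbb S=\bigcup_n\mathbb S_n$; $|s|$ is the $n$ with $s\in\mathbb S_n$; $\mathbf 1_u$ is the indicator of $\{u\}$; $c_{-1}=0$; $(f)_n=f|_{\mathbb S_n}$. A Feller semigroup on $C(E)$ is a semigroup of positive, contractive, conservative ($T(t)1=1$) operators $C(E)\to C(E)$ with $(T(t)f)(x)\to f(x)$ as $t\to0$ for all $f\in C(E)$, $x\in E$. (A0) $\mathbb S_0,\mathbb S_1,\dots$ are finite and pairwise disjoint and $\mathbb S_0=\{\varnothing\}$. $T_n$ is the transition operator of the Markov chain $X_n$ on $\mathbb S_n$, $A_n=c_n(T_n-I)$, $(D_n)_{n\ge1}$ are linear operators, and for all $n\ge0$: (A1) $0<c_n<c_{n+1}$; (A2) $D_{n+1}$ is a transition operator from $C(\mathbb S_n)$ to $C(\mathbb S_{n+1})$; (A3) $\operatorname{range}(A_{n+1}+c_nI)\subset\operatorname{range}D_{n+1}$; (A4) $D_{n+1}$ is injective; (A5) $A_{n+1}D_{n+1}=D_{n+1}A_n$. $U_n:C(\mathbb S_{n+1})\to C(\mathbb S_n)$ is the unique linear operator with $c_nD_{n+1}U_n=A_{n+1}+c_nI$;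 $p^\uparrow_{k,n}(s,u)=(U_k\cdots U_{n-1}\mathbf 1_u)(s)$ for $s\in\mathbb S_k,u\in\mathbb S_n$. $d_s(u)=(D_{|u|}\cdots D_{|s|+1}\mathbf 1_s)(u)$ if $|u|\ge|s|$ ($=\mathbf 1_s(u)$ if $|u|=|s|$), else $0$. $\eta_{i,j}=\prod_{m=i}^{j-1}\frac{c_m}{c_{m-1}-c_{j-1}}$, $h_s=\sum_{|r|\le|s|}p^\uparrow_{|r|,|s|}(r,s)\eta_{|r|,|s|}d_r$. $H=\operatorname{span}\{h_s\}_{s\in\mathbb S}=\operatorname{span}\{d_s\}_{s\in\mathbb S}$ (both families are linearly independent). $Q_t:H\to H$ is linear with $Q_th_s=e^{-tc_{|s|-1}}h_s$. $E$ is a compact metric space, $\iota:\mathbb S\to E$ a map, $d^o_s\in C(E)$, and: (L1) for every $x\in E$ there are $s_n\in\mathbb S_n$ with $\iota(s_n)\to x$; (L2) $\operatorname{span}\{d^o_s\}$ is dense in $C(E)$; (L3) $\|(d_s)_n-d^o_s\circ\iota|_{\mathbb S_n}\|_{C(\mathbb S_n)}\to0$ for each $s$. The map $f\mapsto f^o$ from $H$ to $C(E)$ is linear with $d_s\mapsto d^o_s$; $h^o_s=(h_s)^o$. *)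

theory Defs
  imports "HOL-Analysis.Analysis" "HOL-Library.Function_Algebras"
begin

text \<open>Real functions form a vector space under the pointwise operations; the additive structure
  comes from Function_Algebras, and this instance makes \<^term>\<open>span\<close> and \<^term>\<open>linear\<close> available.\<close>

instantiation "fun" :: (type, real_vector) real_vector
begin

definition scaleR_fun :: "real \<Rightarrow> ('a \<Rightarrow> 'b) \<Rightarrow> 'a \<Rightarrow> 'b"
  where "scaleR_fun r f = (\<lambda>x. r *\<^sub>R f x)"

instance
  by standard (auto simp: scaleR_fun_def fun_eq_iff algebra_simps)

end


subsection \<open>Function spaces over finite sets and transition operators\<close>

text \<open>For a finite set \<open>Z\<close>, a function on \<open>Z\<close> is represented by its extension by zero to the
  ambient type. An operator from \<open>C(Z')\<close> to \<open>C(Z)\<close> is a map on functions on the ambient type;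
  only its values on \<open>CF Z'\<close> are ever used.\<close>

definition CF :: "'a set \<Rightarrow> ('a \<Rightarrow> real) set"
  where "CF Z = {f. \<forall>x. x \<notin> Z \<longrightarrow> f x = 0}"

definition restr :: "'a set \<Rightarrow> ('a \<Rightarrow> real) \<Rightarrow> 'a \<Rightarrow> real"
  where "restr Z f = (\<lambda>x. if x \<in> Z then f x else 0)"

definition sup_norm :: "'a set \<Rightarrow> ('a \<Rightarrow> real) \<Rightarrow> real"
  where "sup_norm Z f = (SUP x\<in>Z. \<bar>f x\<bar>)"

definition stochastic_matrix :: "'a set \<Rightarrow> 'a set \<Rightarrow> ('a \<Rightarrow> 'a \<Rightarrow> real) \<Rightarrow> bool"
  where "stochastic_matrix Z Z' \<mu> \<longleftrightarrow>
    (\<forall>x\<in>Z. (\<forall>y\<in>Z'. 0 \<le> \<mu> x y) \<and> (\<Sum>y\<in>Z'. \<mu> x y) = 1)"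

text \<open>\<open>transition_operator Z' Z L\<close>: \<open>L\<close> maps \<open>C(Z')\<close> to \<open>C(Z)\<close>.\<close>

definition transition_operator ::
    "'a set \<Rightarrow> 'a set \<Rightarrow> (('a \<Rightarrow> real) \<Rightarrow> 'a \<Rightarrow> real) \<Rightarrow> bool"
  where "transition_operator Z' Z L \<longleftrightarrow>
    (\<exists>\<mu>. stochastic_matrix Z Z' \<mu> \<and>
      (\<forall>f\<in>CF Z'. L f = restr Z (\<lambda>x. \<Sum>y\<in>Z'. \<mu> x y * f y)))"


subsection \<open>Objects built from the chains and the down-operators\<close>

text \<open>Throughout, \<open>S n\<close> is the \<open>n\<close>-th state space, \<open>T n\<close> the transition operator of the
  \<open>n\<close>-th chain, \<open>c n\<close> its rate and \<open>D (Suc n)\<close> the down-operator from \<open>C(S n)\<close> to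
  \<open>C(S (Suc n))\<close>; \<open>D 0\<close> is not used.\<close>

definition states :: "(nat \<Rightarrow> 'a set) \<Rightarrow> 'a set"
  where "states S = (\<Union>n. S n)"

definition level :: "(nat \<Rightarrow> 'a set) \<Rightarrow> 'a \<Rightarrow> nat"
  where "level S s = (THE n. s \<in> S n)"

text \<open>\<open>cpred c n\<close> is \<open>c\<^bsub>n-1\<^esub>\<close> with the convention \<open>c\<^bsub>-1\<^esub> = 0\<close>.\<close>

definition cpred :: "(nat \<Rightarrow> real) \<Rightarrow> nat \<Rightarrow> real"
  where "cpred c n = (case n of 0 \<Rightarrow> 0 | Suc m \<Rightarrow> c m)"

definition chain_gen ::
    "(nat \<Rightarrow> real) \<Rightarrow> (nat \<Rightarrow> ('a \<Rightarrow> real) \<Rightarrow> 'a \<Rightarrow> real) \<Rightarrow> nat \<Rightarrow> ('a \<Rightarrow> real) \<Rightarrow> 'a \<Rightarrow> real"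
  where "chain_gen c T n f = c n *\<^sub>R (T n f - f)"

text \<open>\<open>U\<^sub>n\<close> is determined by \<open>c\<^sub>n D\<^bsub>n+1\<^esub> U\<^sub>n = A\<^bsub>n+1\<^esub> + c\<^sub>n I\<close>: the value at each
  \<open>f \<in> C(S (n+1))\<close> exists by (A3) and is unique by (A4).\<close>

definition up_op ::
    "(nat \<Rightarrow> 'a set) \<Rightarrow> (nat \<Rightarrow> real) \<Rightarrow> (nat \<Rightarrow> ('a \<Rightarrow> real) \<Rightarrow> 'a \<Rightarrow> real) \<Rightarrow>
     (nat \<Rightarrow> ('a \<Rightarrow> real) \<Rightarrow> 'a \<Rightarrow> real) \<Rightarrow> nat \<Rightarrow> ('a \<Rightarrow> real) \<Rightarrow> 'a \<Rightarrow> real"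
  where "up_op S c T D n f =
    (THE g. g \<in> CF (S n) \<and> c n *\<^sub>R D (Suc n) g = chain_gen c T (Suc n) f + c n *\<^sub>R f)"

text \<open>\<open>p_up S c T D k n s u\<close> is \<open>(U\<^sub>k \<dots> U\<^bsub>n-1\<^esub> 1\<^sub>u)(s)\<close>.\<close>

definition p_up ::
    "(nat \<Rightarrow> 'a set) \<Rightarrow> (nat \<Rightarrow> real) \<Rightarrow> (nat \<Rightarrow> ('a \<Rightarrow> real) \<Rightarrow> 'a \<Rightarrow> real) \<Rightarrow>
     (nat \<Rightarrow> ('a \<Rightarrow> real) \<Rightarrow> 'a \<Rightarrow> real) \<Rightarrow> nat \<Rightarrow> nat \<Rightarrow> 'a \<Rightarrow> 'a \<Rightarrow> real"
  where "p_up S c T D k n s u = foldr (up_op S c T D) [k..<n] (indicator {u}) s"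

text \<open>The fold applies \<open>D\<close> at index \<open>|s| + 1\<close> first and at index \<open>|u|\<close> last.\<close>

definition d_fun ::
    "(nat \<Rightarrow> 'a set) \<Rightarrow> (nat \<Rightarrow> ('a \<Rightarrow> real) \<Rightarrow> 'a \<Rightarrow> real) \<Rightarrow> 'a \<Rightarrow> 'a \<Rightarrow> real"
  where "d_fun S D s = (\<lambda>u.
    if u \<in> states S \<and> level S s \<le> level S u
    then fold D [Suc (level S s)..<Suc (level S u)] (indicator {s}) u
    else 0)"

definition eta :: "(nat \<Rightarrow> real) \<Rightarrow> nat \<Rightarrow> nat \<Rightarrow> real"
  where "eta c i j = (\<Prod>m\<in>{i..<j}. c m / (cpred c m - cpred c j))"

definition h_fun ::
    "(nat \<Rightarrow> 'a set) \<Rightarrow> (nat \<Rightarrow> real) \<Rightarrow> (nat \<Rightarrow> ('a \<Rightarrow> real) \<Rightarrow> 'a \<Rightarrow> real) \<Rightarrow>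
     (nat \<Rightarrow> ('a \<Rightarrow> real) \<Rightarrow> 'a \<Rightarrow> real) \<Rightarrow> 'a \<Rightarrow> 'a \<Rightarrow> real"
  where "h_fun S c T D s =
    (\<Sum>r\<in>{r \<in> states S. level S r \<le> level S s}.
      (p_up S c T D (level S r) (level S s) r s * eta c (level S r) (level S s)) *\<^sub>R d_fun S D r)"

definition H_space ::
    "(nat \<Rightarrow> 'a set) \<Rightarrow> (nat \<Rightarrow> ('a \<Rightarrow> real) \<Rightarrow> 'a \<Rightarrow> real) \<Rightarrow> ('a \<Rightarrow> real) set"
  where "H_space S D = span (d_fun S D ` states S)"

text \<open>The linear map with \<open>h\<^sub>s \<mapsto> e\<^bsup>-tc\<^esup> h\<^sub>s\<close>, \<open>c\<close> being the rate of index \<open>|s| - 1\<close>. Since the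
  \<open>h\<^sub>s\<close> are linearly independent, such a map exists, and its values on their span, which is
  \<open>H\<close>, do not depend on the choice; only these values are used.\<close>

definition Q_op ::
    "(nat \<Rightarrow> 'a set) \<Rightarrow> (nat \<Rightarrow> real) \<Rightarrow> (nat \<Rightarrow> ('a \<Rightarrow> real) \<Rightarrow> 'a \<Rightarrow> real) \<Rightarrow>
     (nat \<Rightarrow> ('a \<Rightarrow> real) \<Rightarrow> 'a \<Rightarrow> real) \<Rightarrow> real \<Rightarrow> ('a \<Rightarrow> real) \<Rightarrow> 'a \<Rightarrow> real"
  where "Q_op S c T D t =
    (SOME L. linear L \<and>
      (\<forall>s\<in>states S. L (h_fun S c T D s) = exp (- t * cpred c (level S s)) *\<^sub>R h_fun S c T D s))"


subsection \<open>The limit space\<close>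

text \<open>The compact metric space \<open>E\<close> is a type, assumed compact in the theorem, so that \<open>C(E)\<close> with
  its sup norm is the type of bounded continuous functions.\<close>

definition proj ::
    "(nat \<Rightarrow> 'a set) \<Rightarrow> ('a \<Rightarrow> 'e::metric_space) \<Rightarrow> nat \<Rightarrow> ('e \<Rightarrow>\<^sub>C real) \<Rightarrow> 'a \<Rightarrow> real"
  where "proj S \<iota> n f = restr (S n) (\<lambda>x. apply_bcontfun f (\<iota> x))"

text \<open>The convergence \<open>f\<^sub>n \<rightarrow> f\<close> for \<open>f\<^sub>n \<in> C(S n)\<close> and \<open>f \<in> C(E)\<close>.\<close>

definition conv_to ::
    "(nat \<Rightarrow> 'a set) \<Rightarrow> ('a \<Rightarrow> 'e::metric_space) \<Rightarrow> (nat \<Rightarrow> 'a \<Rightarrow> real) \<Rightarrow> ('e \<Rightarrow>\<^sub>C real) \<Rightarrow> bool"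
  where "conv_to S \<iota> F f \<longleftrightarrow> (\<lambda>n. sup_norm (S n) (F n - proj S \<iota> n f)) \<longlonglongrightarrow> 0"

text \<open>The linear map \<open>f \<mapsto> f\<^sup>o\<close> with \<open>d\<^sub>s \<mapsto> d\<^sup>o\<^sub>s\<close>. Again the \<open>d\<^sub>s\<close> are linearly independent and only
  the values on \<open>H\<close>, which do not depend on the choice, are used.\<close>

definition lift_o ::
    "(nat \<Rightarrow> 'a set) \<Rightarrow> (nat \<Rightarrow> ('a \<Rightarrow> real) \<Rightarrow> 'a \<Rightarrow> real) \<Rightarrow> ('a \<Rightarrow> 'e::metric_space \<Rightarrow>\<^sub>C real) \<Rightarrow>
     ('a \<Rightarrow> real) \<Rightarrow> 'e \<Rightarrow>\<^sub>C real"
  where "lift_o S D d\<^sub>o = (SOME L. linear L \<and> (\<forall>s\<in>states S. L (d_fun S D s) = d\<^sub>o s))"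

definition limit_op ::
    "(nat \<Rightarrow> 'a set) \<Rightarrow> (nat \<Rightarrow> ('a \<Rightarrow> real) \<Rightarrow> 'a \<Rightarrow> real) \<Rightarrow> ('a \<Rightarrow> 'e::metric_space) \<Rightarrow>
     (nat \<Rightarrow> real) \<Rightarrow> real \<Rightarrow> ('e \<Rightarrow>\<^sub>C real) \<Rightarrow> 'e \<Rightarrow>\<^sub>C real"
  where "limit_op S T \<iota> \<epsilon> t f =
    (THE g. conv_to S \<iota> (\<lambda>n. (T n ^^ nat \<lfloor>t / \<epsilon> n\<rfloor>) (proj S \<iota> n f)) g)"


subsection \<open>Feller semigroups, generators and cores\<close>

definition feller_semigroup ::
    "(real \<Rightarrow> ('e::metric_space \<Rightarrow>\<^sub>C real) \<Rightarrow> 'e \<Rightarrow>\<^sub>C real) \<Rightarrow> bool"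
  where "feller_semigroup P \<longleftrightarrow>
    P 0 = id \<and>
    (\<forall>s\<ge>0. \<forall>t\<ge>0. P (s + t) = P s \<circ> P t) \<and>
    (\<forall>t\<ge>0. linear (P t)) \<and>
    (\<forall>t\<ge>0. \<forall>f. (\<forall>x. 0 \<le> apply_bcontfun f x) \<longrightarrow> (\<forall>x. 0 \<le> apply_bcontfun (P t f) x)) \<and>
    (\<forall>t\<ge>0. \<forall>f. norm (P t f) \<le> norm f) \<and>
    (\<forall>t\<ge>0. P t (const_bcontfun 1) = const_bcontfun 1) \<and>
    (\<forall>f x. ((\<lambda>t. apply_bcontfun (P t f) x) \<longlongrightarrow> apply_bcontfun f x) (at_right 0))"

definition gen_domain :: "(real \<Rightarrow> 'b \<Rightarrow> 'b) \<Rightarrow> 'b::real_normed_vector set"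
  where "gen_domain P = {f. \<exists>g. ((\<lambda>t. (P t f - f) /\<^sub>R t) \<longlongrightarrow> g) (at_right 0)}"

definition gen :: "(real \<Rightarrow> 'b \<Rightarrow> 'b) \<Rightarrow> 'b::real_normed_vector \<Rightarrow> 'b"
  where "gen P f = Lim (at_right 0) (\<lambda>t. (P t f - f) /\<^sub>R t)"

text \<open>A core is a subspace of the domain such that the closure of the restriction of the operator
  to it (in the sense of graphs) is the operator itself.\<close>

definition is_core :: "(real \<Rightarrow> 'b \<Rightarrow> 'b) \<Rightarrow> 'b::real_normed_vector set \<Rightarrow> bool"
  where "is_core P V \<longleftrightarrow>
    subspace V \<and> V \<subseteq> gen_domain P \<and>
    closure ((\<lambda>f. (f, gen P f)) ` V) = (\<lambda>f. (f, gen P f)) ` gen_domain P"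

end

theory Submission
  imports Defs "HOL-Real_Asymp.Real_Asymp"
begin

text \<open>Put \<open>G\<^sub>i = D\<^sub>n \<dots> D\<^bsub>i+1\<^esub> U\<^sub>i \<dots> U\<^bsub>k-1\<^esub> 1\<^sub>s\<close> for \<open>s\<close> of level \<open>k \<le> n\<close>. The intertwining relation
  and the definition of \<open>U\<close> give \<open>A\<^sub>n G\<^sub>i = c\<^bsub>i-1\<^esub> (G\<^bsub>i-1\<^esub> - G\<^sub>i)\<close>, and the weights \<open>\<eta>\<close> are exactly those for
  which the combination \<open>h\<^sub>s\<close> of the \<open>G\<^sub>i\<close> telescopes to an eigenvector of \<open>A\<^sub>n\<close> with eigenvalue
  \<open>-c\<^bsub>k-1\<^esub>\<close>, simultaneously for all \<open>n \<ge> k\<close>. Hence \<open>T\<^sub>n\<close> acts on \<open>h\<^sub>s\<close> as \<open>1 - c\<^bsub>k-1\<^esub> / c\<^sub>n\<close>, whose power of order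
  \<open>t c\<^sub>n\<close> tends to \<open>exp (- t c\<^bsub>k-1\<^esub>)\<close>. As the \<open>T\<^sub>n\<close> are contractions, the set of \<open>f\<close> for which the limit
  exists is a closed subspace, so it is all of \<open>C(E)\<close>. The limit operators are contractions with
  a total family of common eigenvectors, which gives the semigroup property and strong continuity
  by density. The resolvent equation is solvable on the span of the eigenvectors, and since the
  generator is dissipative, this span is a core.\<close>

subsection \<open>Contraction semigroups with a total family of eigenvectors\<close>

text \<open>This abstract setting serves the semigroup, generator and core statements; it is
  instantiated at the end with the limit operators, the vectors \<open>h\<^sub>o s\<close> and the
  rates \<open>cpred c (level S s)\<close>. The semigroup law and strong continuity are left out of
  the assumptions because they follow from contractivity and the density of the
  eigenvectors.\<close>

locale eigen_contractions =
  fixes P :: "real \<Rightarrow> 'b::real_normed_vector \<Rightarrow> 'b"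
    and I :: "'i set" and h :: "'i \<Rightarrow> 'b" and l :: "'i \<Rightarrow> real"
  assumes P_linear: "0 \<le> t \<Longrightarrow> linear (P t)"
    and P_contraction: "0 \<le> t \<Longrightarrow> norm (P t f) \<le> norm f"
    and P_eigen: "0 \<le> t \<Longrightarrow> i \<in> I \<Longrightarrow> P t (h i) = exp (- t * l i) *\<^sub>R h i"
    and l_nonneg: "i \<in> I \<Longrightarrow> 0 \<le> l i"
    and span_dense: "closure (span (h ` I)) = UNIV"
begin

lemma P_bounded_linear: "0 \<le> t \<Longrightarrow> bounded_linear (P t)"
  using P_linear[of t] P_contraction[of t]
  by (auto intro!: bounded_linear_intro[where K = 1] simp: linear_add linear_scale)

lemma P_dist: "0 \<le> t \<Longrightarrow> norm (P t f - P t g) \<le> norm (f - g)"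
  using P_contraction[of t "f - g"] by (simp add: linear_diff P_linear)

text \<open>Agreement on the \<open>h i\<close> extends to the span by linearity and to its closure
  because the set of agreement is closed. The semigroup laws thereby reduce to identities between
  exponentials.\<close>

lemma bounded_linear_eqI:
  assumes "bounded_linear F" "bounded_linear G" "\<And>i. i \<in> I \<Longrightarrow> F (h i) = G (h i)"
  shows "F = G"
proof
  fix x
  have "x \<in> closure (span (h ` I))"
    by (simp add: span_dense)
  moreover have "closed {x. F x = G x}"
    by (rule closed_Collect_eq) (rule assms(1,2)[THEN linear_continuous_on])+
  moreover have "F x = G x" if "x \<in> span (h ` I)" for x
    using linear_eq_on_span[of F G "h ` I" x] assms that by (auto simp: bounded_linear.linear)
  ultimately show "F x = G x"
    using closure_minimal[of "span (h ` I)" "{x. F x = G x}"] by auto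
qed

lemma P_zero: "P 0 = id"
  by (rule bounded_linear_eqI) (auto simp: P_bounded_linear P_eigen id_def bounded_linear_ident)

lemma P_add:
  assumes "0 \<le> s" "0 \<le> t"
  shows "P (s + t) = P s \<circ> P t"
proof (rule bounded_linear_eqI)
  show "bounded_linear (P s \<circ> P t)"
    unfolding comp_def
    using bounded_linear_compose[OF P_bounded_linear[OF assms(1)] P_bounded_linear[OF assms(2)]] .
  show "bounded_linear (P (s + t))"
    using assms by (intro P_bounded_linear) simp
  fix i assume i: "i \<in> I"
  have "exp (- ((s + t) * l i)) = exp (- t * l i) * exp (- s * l i)"
    by (simp add: algebra_simps flip: exp_add)
  then show "P (s + t) (h i) = (P s \<circ> P t) (h i)"
    using assms i linear_scale[OF P_linear, of s "exp (- t * l i)" "h i"] P_eigen[OF _ i]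
    by simp
qed

text \<open>The orbit of \<open>h i\<close> is a scalar exponential times \<open>h i\<close>, so
  \<open>w = - l i *\<^sub>R h i\<close> works there. The form with one \<open>w\<close> for all
  \<open>t\<close> is stable under linear combinations, which lets \<open>span_minimal\<close> do
  the rest. Derivatives are taken within \<open>{0..}\<close> because \<open>P\<close> is controlled
  only for nonnegative times.\<close>

lemma P_has_derivative_on_span:
  assumes "v \<in> span (h ` I)"
  shows "\<exists>w\<in>span (h ` I). \<forall>t\<ge>0. ((\<lambda>s. P s v) has_vector_derivative P t w) (at t within {0..})"
proof -
  let ?V = "{v. \<exists>w\<in>span (h ` I). \<forall>t\<ge>0.
    ((\<lambda>s. P s v) has_vector_derivative P t w) (at t within {0..})}"
  have "subspace ?V"
  proof (rule subspaceI)
    have "((\<lambda>s. P s 0) has_vector_derivative P t 0) (at t within {0..})" if "t \<ge> 0" for t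
    proof (rule has_vector_derivative_transform)
      show "((\<lambda>s. 0) has_vector_derivative P t 0) (at t within {0..})"
        using that by (simp add: linear_0 P_linear)
    qed (use that in \<open>auto simp: linear_0 P_linear\<close>)
    then show "0 \<in> ?V"
      using span_zero by blast
  next
    fix x y assume "x \<in> ?V" "y \<in> ?V"
    then obtain v w where vw: "v \<in> span (h ` I)" "w \<in> span (h ` I)"
      and v: "\<And>t. t \<ge> 0 \<Longrightarrow> ((\<lambda>s. P s x) has_vector_derivative P t v) (at t within {0..})"
      and w: "\<And>t. t \<ge> 0 \<Longrightarrow> ((\<lambda>s. P s y) has_vector_derivative P t w) (at t within {0..})"
      by auto
    have "((\<lambda>s. P s (x + y)) has_vector_derivative P t (v + w)) (at t within {0..})" if "t \<ge> 0" for t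
    proof (rule has_vector_derivative_transform)
      show "((\<lambda>s. P s x + P s y) has_vector_derivative P t (v + w)) (at t within {0..})"
        using that by (auto intro!: has_vector_derivative_add v w simp: linear_add P_linear)
    qed (use that in \<open>auto simp: linear_add P_linear\<close>)
    then show "x + y \<in> ?V"
      using vw by (auto intro: span_add)
  next
    fix a x assume "x \<in> ?V"
    then obtain v where vw: "v \<in> span (h ` I)"
      and v: "\<And>t. t \<ge> 0 \<Longrightarrow> ((\<lambda>s. P s x) has_vector_derivative P t v) (at t within {0..})"
      by auto
    have "((\<lambda>s. P s (a *\<^sub>R x)) has_vector_derivative P t (a *\<^sub>R v)) (at t within {0..})" if "t \<ge> 0" for t
    proof (rule has_vector_derivative_transform)
      show "((\<lambda>s. a *\<^sub>R P s x) has_vector_derivative P t (a *\<^sub>R v)) (at t within {0..})"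
        using that bounded_linear.has_vector_derivative[OF bounded_linear_scaleR_right v, of t a]
        by (simp add: linear_scale P_linear)
    qed (use that in \<open>auto simp: linear_scale P_linear\<close>)
    then show "a *\<^sub>R x \<in> ?V"
      using vw by (auto intro: span_scale)
  qed
  moreover have "h ` I \<subseteq> ?V"
  proof safe
    fix i assume i: "i \<in> I"
    have "((\<lambda>s. P s (h i)) has_vector_derivative P t (- l i *\<^sub>R h i)) (at t within {0..})"
      if "t \<ge> 0" for t
    proof (rule has_vector_derivative_transform)
      have "((\<lambda>s. exp (- s * l i)) has_real_derivative - l i * exp (- t * l i)) (at t within {0..})"
        by (auto intro!: derivative_eq_intros)
      from has_vector_derivative_scaleR[OF this has_vector_derivative_const[of "h i"]] that
      show "((\<lambda>s. exp (- s * l i) *\<^sub>R h i) has_vector_derivative P t (- l i *\<^sub>R h i)) (at t within {0..})"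
        using linear_scale[OF P_linear[OF that], of "- l i" "h i"] i
        by (simp add: P_eigen)
    qed (use that i in \<open>auto simp: P_eigen\<close>)
    then show "\<exists>w\<in>span (h ` I). \<forall>t\<ge>0.
        ((\<lambda>s. P s (h i)) has_vector_derivative P t w) (at t within {0..})"
      using i by (intro bexI[of _ "- l i *\<^sub>R h i"] allI impI) (simp_all only: span_scale span_base imageI)
  qed
  ultimately show ?thesis
    using span_minimal[of "h ` I" ?V] assms by blast
qed

text \<open>Orbits of vectors in the span are differentiable, hence continuous at 0. Approximating
  \<open>f\<close> by such a vector costs at most a third of the error at each end, uniformly in
  \<open>t\<close>, by contractivity.\<close>

lemma P_strongly_continuous: "((\<lambda>t. P t f) \<longlongrightarrow> f) (at_right 0)"
proof (rule tendstoI)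
  fix e :: real assume e: "0 < e"
  have "f \<in> closure (span (h ` I))"
    by (simp add: span_dense)
  then obtain v where v: "v \<in> span (h ` I)" "dist v f < e / 3"
    using e by (meson closure_approachable divide_pos_pos zero_less_numeral)
  obtain w where "((\<lambda>s. P s v) has_vector_derivative P 0 w) (at 0 within {0..})"
    using P_has_derivative_on_span[OF v(1)] by auto
  then have "continuous (at 0 within {0..}) (\<lambda>s. P s v)"
    by (rule has_vector_derivative_continuous)
  then have "((\<lambda>s. P s v) \<longlongrightarrow> v) (at 0 within {0..})"
    by (simp add: continuous_within P_zero)
  then have "((\<lambda>s. P s v) \<longlongrightarrow> v) (at_right 0)"
    by (rule tendsto_within_subset) auto
  then have "\<forall>\<^sub>F t in at_right 0. dist (P t v) v < e / 3"
    using e by (intro tendstoD) auto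
  moreover have "\<forall>\<^sub>F t::real in at_right 0. t > 0"
    by (rule eventually_at_right_less)
  ultimately show "\<forall>\<^sub>F t in at_right 0. dist (P t f) f < e"
  proof eventually_elim
    case (elim t)
    have "dist (P t f) (P t v) \<le> dist f v"
      using P_dist[of t f v] elim by (simp add: dist_norm)
    then show ?case
      using elim v(2) dist_triangle[of "P t f" f v] dist_triangle[of "P t f" v "P t v"]
      by (simp add: dist_commute)
  qed
qed

section \<open>The generator: algebra, dissipativity and closedness\<close>

lemma gen_eqI:
  assumes "((\<lambda>t. (P t f - f) /\<^sub>R t) \<longlongrightarrow> g) (at_right 0)"
  shows "f \<in> gen_domain P" "gen P f = g"
  using assms by (auto simp: gen_domain_def gen_def intro!: tendsto_Lim)

lemma gen_tendsto:
  assumes "f \<in> gen_domain P"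
  shows "((\<lambda>t. (P t f - f) /\<^sub>R t) \<longlongrightarrow> gen P f) (at_right 0)"
  using assms gen_eqI by (auto simp: gen_domain_def)

text \<open>The vector \<open>w\<close> of \<open>P_has_derivative_on_span\<close> is
  \<open>gen P v\<close>: the right derivative of the orbit at 0 is the limit of the difference
  quotients. Hence the span is invariant under the generator, and the derivative of the orbit at
  \<open>t\<close> is \<open>P t (gen P v)\<close>.\<close>

lemma span_gen:
  assumes "v \<in> span (h ` I)"
  shows "v \<in> gen_domain P" "gen P v \<in> span (h ` I)"
    and "0 \<le> t \<Longrightarrow> ((\<lambda>s. P s v) has_vector_derivative P t (gen P v)) (at t within {0..})"
proof -
  obtain w where w: "w \<in> span (h ` I)"
    and der: "\<And>t. t \<ge> 0 \<Longrightarrow> ((\<lambda>s. P s v) has_vector_derivative P t w) (at t within {0..})"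
    using P_has_derivative_on_span[OF assms] by blast
  have "((\<lambda>s. P s v) has_vector_derivative w) (at 0 within {0..})"
    using der[of 0] by (simp add: P_zero)
  then have "((\<lambda>s. P s v) has_vector_derivative w) (at_right 0)"
    by (rule has_vector_derivative_within_subset) auto
  then have "((\<lambda>t. (P t v - v - t *\<^sub>R w) /\<^sub>R norm t) \<longlongrightarrow> 0) (at_right 0)"
    by (simp add: has_vector_derivative_def has_derivative_at_within P_zero)
  then have "((\<lambda>t. (P t v - v) /\<^sub>R t - w) \<longlongrightarrow> 0) (at_right 0)"
    by (rule Lim_transform_eventually)
       (use eventually_at_right_less[of 0] in eventually_elim, simp add: scaleR_diff_right)
  then have "((\<lambda>t. (P t v - v) /\<^sub>R t) \<longlongrightarrow> w) (at_right 0)"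
    by (rule LIM_zero_cancel)
  then show "v \<in> gen_domain P" "gen P v \<in> span (h ` I)"
    "0 \<le> t \<Longrightarrow> ((\<lambda>s. P s v) has_vector_derivative P t (gen P v)) (at t within {0..})"
    using gen_eqI w der by auto
qed

lemma gen_diff:
  assumes "f \<in> gen_domain P" "g \<in> gen_domain P"
  shows "f - g \<in> gen_domain P" "gen P (f - g) = gen P f - gen P g"
proof -
  have "((\<lambda>t. (P t f - f) /\<^sub>R t - (P t g - g) /\<^sub>R t) \<longlongrightarrow> gen P f - gen P g) (at_right 0)"
    by (intro tendsto_diff gen_tendsto assms)
  then have "((\<lambda>t. (P t (f - g) - (f - g)) /\<^sub>R t) \<longlongrightarrow> gen P f - gen P g) (at_right 0)"
    by (rule Lim_transform_eventually)
       (use eventually_at_right_less[of 0] in eventually_elim,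
         simp add: linear_diff P_linear algebra_simps)
  then show "f - g \<in> gen_domain P" "gen P (f - g) = gen P f - gen P g"
    using gen_eqI by auto
qed

lemma gen_add:
  assumes "f \<in> gen_domain P" "g \<in> gen_domain P"
  shows "gen P (f + g) = gen P f + gen P g"
proof -
  have "((\<lambda>t. (P t f - f) /\<^sub>R t + (P t g - g) /\<^sub>R t) \<longlongrightarrow> gen P f + gen P g) (at_right 0)"
    by (intro tendsto_add gen_tendsto assms)
  then have "((\<lambda>t. (P t (f + g) - (f + g)) /\<^sub>R t) \<longlongrightarrow> gen P f + gen P g) (at_right 0)"
    by (rule Lim_transform_eventually)
       (use eventually_at_right_less[of 0] in eventually_elim,
         simp add: linear_add P_linear algebra_simps)
  then show ?thesis
    using gen_eqI by auto
qed

lemma gen_scale: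
  assumes "f \<in> gen_domain P"
  shows "gen P (a *\<^sub>R f) = a *\<^sub>R gen P f"
proof -
  have "((\<lambda>t. a *\<^sub>R ((P t f - f) /\<^sub>R t)) \<longlongrightarrow> a *\<^sub>R gen P f) (at_right 0)"
    by (intro tendsto_scaleR tendsto_const gen_tendsto assms)
  then have "((\<lambda>t. (P t (a *\<^sub>R f) - a *\<^sub>R f) /\<^sub>R t) \<longlongrightarrow> a *\<^sub>R gen P f) (at_right 0)"
    by (rule Lim_transform_eventually)
       (use eventually_at_right_less[of 0] in eventually_elim,
         simp add: linear_scale P_linear algebra_simps)
  then show ?thesis
    using gen_eqI by auto
qed

lemma gen_eigen:
  assumes "i \<in> I"
  shows "gen P (h i) = - l i *\<^sub>R h i"
proof -
  have "((\<lambda>t. (exp (- t * l i) - 1) / t) \<longlongrightarrow> - l i) (at_right 0)"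
    by real_asymp
  then have "((\<lambda>t. ((exp (- t * l i) - 1) / t) *\<^sub>R h i) \<longlongrightarrow> - l i *\<^sub>R h i) (at_right 0)"
    by (intro tendsto_scaleR tendsto_const)
  then have "((\<lambda>t. (P t (h i) - h i) /\<^sub>R t) \<longlongrightarrow> - l i *\<^sub>R h i) (at_right 0)"
    by (rule Lim_transform_eventually)
       (use eventually_at_right_less[of 0] in eventually_elim,
         simp add: P_eigen assms divide_inverse algebra_simps)
  then show ?thesis
    by (rule gen_eqI)
qed

text \<open>Before the limit, \<open>f - (P t f - f) /\<^sub>R t\<close> equals
  \<open>(1 + 1/t) f - (1/t) P t f\<close>, whose norm is at least
  \<open>(1 + 1/t - 1/t) * norm f\<close> by contractivity. The estimate makes
  \<open>1 - gen P\<close> bounded below, as the core argument requires.\<close>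

lemma gen_dissipative:
  assumes "f \<in> gen_domain P"
  shows "norm f \<le> norm (f - gen P f)"
proof (rule tendsto_lowerbound)
  show "((\<lambda>t. norm (f - (P t f - f) /\<^sub>R t)) \<longlongrightarrow> norm (f - gen P f)) (at_right 0)"
    by (intro tendsto_norm tendsto_diff tendsto_const gen_tendsto assms)
  show "\<forall>\<^sub>F t in at_right 0. norm f \<le> norm (f - (P t f - f) /\<^sub>R t)"
    using eventually_at_right_less[of 0]
  proof eventually_elim
    case (elim t)
    have "f - (P t f - f) /\<^sub>R t = (1 + inverse t) *\<^sub>R f - inverse t *\<^sub>R P t f"
      by (simp add: algebra_simps)
    moreover have "norm ((1 + inverse t) *\<^sub>R f) = (1 + inverse t) * norm f"
      using elim by simp
    moreover have "norm (inverse t *\<^sub>R P t f) \<le> inverse t * norm f"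
      using elim P_contraction[of t f] by simp
    ultimately show ?case
      using norm_triangle_ineq2[of "(1 + inverse t) *\<^sub>R f" "inverse t *\<^sub>R P t f"]
      by (simp add: algebra_simps)
  qed
qed simp

text \<open>The function \<open>\<lambda>s. P s v - s *\<^sub>R gen P v\<close> has derivative
  \<open>P s (gen P v) - gen P v\<close>, so this is the mean value inequality on
  \<open>{0..t}\<close>.\<close>

lemma norm_increment_le:
  assumes v: "v \<in> span (h ` I)" and t: "0 \<le> t"
    and B: "\<And>s. 0 \<le> s \<Longrightarrow> s \<le> t \<Longrightarrow> norm (P s (gen P v) - gen P v) \<le> B"
  shows "norm (P t v - v - t *\<^sub>R gen P v) \<le> t * B"
proof -
  let ?w = "gen P v"
  have "norm ((P t v - t *\<^sub>R ?w) - (P 0 v - 0 *\<^sub>R ?w)) \<le> B * norm (t - 0)"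
  proof (rule differentiable_bound[where S = "{0..t}" and f = "\<lambda>s. P s v - s *\<^sub>R ?w"
        and f' = "\<lambda>s x. x *\<^sub>R (P s ?w - ?w)"])
    fix s assume s: "s \<in> {0..t}"
    have "((\<lambda>s. P s v) has_vector_derivative P s ?w) (at s within {0..t})"
      using span_gen(3)[OF v, of s] s by (auto intro: has_vector_derivative_within_subset)
    then have "((\<lambda>s. P s v - s *\<^sub>R ?w) has_vector_derivative (P s ?w - ?w)) (at s within {0..t})"
      by (auto intro!: derivative_eq_intros)
    then show "((\<lambda>s. P s v - s *\<^sub>R ?w) has_derivative (\<lambda>x. x *\<^sub>R (P s ?w - ?w))) (at s within {0..t})"
      by (simp add: has_vector_derivative_def)
    show "onorm (\<lambda>x. x *\<^sub>R (P s ?w - ?w)) \<le> B"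
      using B[of s] s by (intro onorm_le) (auto simp: mult.commute[of B] intro!: mult_left_mono)
  qed (use t in auto)
  then show ?thesis
    using t by (simp add: P_zero algebra_simps)
qed

text \<open>Passing to the limit in the mean value inequality replaces the usual integral formula
  for \<^term>\<open>P t f - f\<close>.\<close>

lemma gen_closed:
  assumes "\<And>j. v j \<in> span (h ` I)" "v \<longlonglongrightarrow> f" "(\<lambda>j. gen P (v j)) \<longlonglongrightarrow> g"
  shows "((\<lambda>t. (P t f - f) /\<^sub>R t) \<longlongrightarrow> g) (at_right 0)"
proof (rule tendstoI)
  fix e :: real assume e: "0 < e"
  have "\<forall>\<^sub>F t in at_right 0. dist (P t g) g < e / 2"
    using P_strongly_continuous e by (intro tendstoD) auto
  then obtain \<delta> where \<delta>: "\<delta> > 0" "\<And>t. 0 < t \<Longrightarrow> t < \<delta> \<Longrightarrow> dist (P t g) g < e / 2"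
    by (auto simp: eventually_at_right_field)
  have "dist ((P t f - f) /\<^sub>R t) g < e" if t: "0 < t" "t < \<delta>" for t
  proof -
    \<comment> \<open>Strong continuity at \<open>g\<close> contributes \<open>e / 2\<close>.
      Replacing \<open>gen P (v j)\<close> by \<open>g\<close> costs its distance to
      \<open>g\<close> twice: once under \<open>P s\<close>, by contractivity, and once
      outside.\<close>
    have le: "norm (P t (v j) - v j - t *\<^sub>R gen P (v j)) \<le> t * (e / 2 + 2 * norm (gen P (v j) - g))"
      for j
    proof (rule norm_increment_le)
      fix s assume s: "0 \<le> s" "s \<le> t"
      have "norm (P s g - g) \<le> e / 2"
        using \<delta>(2)[of s] s t e by (cases "s = 0") (auto simp: P_zero dist_norm)
      moreover have "norm (P s (gen P (v j)) - P s g) \<le> norm (gen P (v j) - g)"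
        using s by (intro P_dist)
      moreover have "P s (gen P (v j)) - gen P (v j) =
          (P s (gen P (v j)) - P s g) + (P s g - g) - (gen P (v j) - g)"
        by simp
      ultimately show "norm (P s (gen P (v j)) - gen P (v j)) \<le> e / 2 + 2 * norm (gen P (v j) - g)"
        by (smt (verit) norm_triangle_ineq norm_triangle_ineq4)
    qed (use assms t in auto)
    \<comment> \<open>The vanishing term \<open>norm (g - g)\<close> is kept because the bound for
      \<open>v j\<close> converges to exactly this expression.\<close>
    have "norm (P t f - f - t *\<^sub>R g) \<le> t * (e / 2 + 2 * norm (g - g))"
    proof (rule tendsto_le[OF sequentially_bot])
      show "(\<lambda>j. norm (P t (v j) - v j - t *\<^sub>R gen P (v j))) \<longlonglongrightarrow> norm (P t f - f - t *\<^sub>R g)"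
        using t by (intro tendsto_intros assms bounded_linear.tendsto[OF P_bounded_linear]) auto
      show "(\<lambda>j. t * (e / 2 + 2 * norm (gen P (v j) - g))) \<longlonglongrightarrow> t * (e / 2 + 2 * norm (g - g))"
        by (intro tendsto_intros assms)
    qed (use le in auto)
    moreover have "(P t f - f) /\<^sub>R t - g = (P t f - f - t *\<^sub>R g) /\<^sub>R t"
      using t by (simp add: algebra_simps)
    ultimately have "norm ((P t f - f) /\<^sub>R t - g) \<le> e / 2"
      using t by (simp only: norm_scaleR) (simp add: field_simps)
    then show ?thesis
      using e by (simp add: dist_norm)
  qed
  then show "\<forall>\<^sub>F t in at_right 0. dist ((P t f - f) /\<^sub>R t) g < e"
    unfolding eventually_at_right_field using \<delta>(1) by (intro exI[of _ \<delta>]) auto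
qed

text \<open>Since \<open>1 - gen P\<close> multiplies \<open>h i\<close> by \<open>1 + l i\<close>,
  which is nonzero as \<open>l i\<close> is nonnegative, every eigenvector lies in the image of the
  span, and this image is a subspace.\<close>

lemma span_subset_range_resolvent:
  assumes "w \<in> span (h ` I)"
  shows "\<exists>v\<in>span (h ` I). v - gen P v = w"
proof -
  let ?W = "(\<lambda>v. v - gen P v) ` span (h ` I)"
  have "subspace ?W"
  proof (rule subspaceI)
    show "0 \<in> ?W"
      using gen_scale[OF span_gen(1)[OF span_zero], of 0] by (auto intro!: image_eqI[of _ _ 0] span_zero)
    show "x + y \<in> ?W" if xy: "x \<in> ?W" "y \<in> ?W" for x y
    proof -
      obtain u v where "u \<in> span (h ` I)" "v \<in> span (h ` I)" "x = u - gen P u" "y = v - gen P v"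
        using xy by auto
      then show ?thesis
        using gen_add[of u v] span_gen(1) by (auto intro!: image_eqI[of _ _ "u + v"] span_add)
    qed
    show "a *\<^sub>R x \<in> ?W" if x: "x \<in> ?W" for a x
    proof -
      obtain u where "u \<in> span (h ` I)" "x = u - gen P u"
        using x by auto
      then show ?thesis
        using gen_scale[of u a] span_gen(1)
        by (auto intro!: image_eqI[of _ _ "a *\<^sub>R u"] span_scale simp: scaleR_diff_right)
    qed
  qed
  moreover have "h ` I \<subseteq> ?W"
  proof safe
    fix i assume i: "i \<in> I"
    have pos: "1 + l i \<noteq> 0"
      using l_nonneg[OF i] by linarith
    have "gen P (inverse (1 + l i) *\<^sub>R h i) = inverse (1 + l i) *\<^sub>R (- l i *\<^sub>R h i)"
      using i by (simp only: gen_scale[OF span_gen(1)[OF span_base[OF imageI[OF i]]]] gen_eigen)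
    then have "inverse (1 + l i) *\<^sub>R h i - gen P (inverse (1 + l i) *\<^sub>R h i)
        = (inverse (1 + l i) * (1 + l i)) *\<^sub>R h i"
      by (simp add: algebra_simps)
    also have "\<dots> = h i"
      using pos by simp
    finally show "h i \<in> ?W"
      using i by (intro image_eqI[of _ _ "inverse (1 + l i) *\<^sub>R h i"]) (auto intro: span_scale span_base)
  qed
  ultimately show ?thesis
    using span_minimal[of "h ` I" ?W] assms by auto
qed

text \<open>One inclusion is \<open>gen_closed\<close>. For the other, \<open>f - gen P f\<close> is
  approximated by \<open>w j\<close> in the span, and \<open>v j - gen P (v j) = w j\<close> is
  solved inside the span. Dissipativity applied to \<open>v j - f\<close> gives convergence of
  \<open>v j\<close> to \<open>f\<close>, and then \<open>gen P (v j) = v j - w j\<close> converges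
  to \<open>gen P f\<close>.\<close>

lemma span_is_core: "is_core P (span (h ` I))"
  unfolding is_core_def
proof (intro conjI subset_antisym)
  show "span (h ` I) \<subseteq> gen_domain P"
    using span_gen(1) by auto
  show "closure ((\<lambda>f. (f, gen P f)) ` span (h ` I)) \<subseteq> (\<lambda>f. (f, gen P f)) ` gen_domain P"
  proof
    fix p assume "p \<in> closure ((\<lambda>f. (f, gen P f)) ` span (h ` I))"
    then obtain q where q: "\<And>j. q j \<in> (\<lambda>f. (f, gen P f)) ` span (h ` I)" "q \<longlonglongrightarrow> p"
      unfolding closure_sequential by auto
    have "(\<lambda>j. fst (q j)) \<longlonglongrightarrow> fst p" "(\<lambda>j. snd (q j)) \<longlonglongrightarrow> snd p"
      using q(2) by (auto intro: tendsto_fst tendsto_snd)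
    moreover have "fst (q j) \<in> span (h ` I)" "snd (q j) = gen P (fst (q j))" for j
      using q(1)[of j] by auto
    ultimately have "((\<lambda>t. (P t (fst p) - fst p) /\<^sub>R t) \<longlongrightarrow> snd p) (at_right 0)"
      by (intro gen_closed[of "\<lambda>j. fst (q j)"]) auto
    then show "p \<in> (\<lambda>f. (f, gen P f)) ` gen_domain P"
      using gen_eqI by (auto intro!: image_eqI[of _ _ "fst p"] simp: prod_eq_iff)
  qed
  show "(\<lambda>f. (f, gen P f)) ` gen_domain P \<subseteq> closure ((\<lambda>f. (f, gen P f)) ` span (h ` I))"
  proof safe
    fix f assume f: "f \<in> gen_domain P"
    have "f - gen P f \<in> closure (span (h ` I))"
      by (simp add: span_dense)
    then obtain w where w: "\<And>j. w j \<in> span (h ` I)" "w \<longlonglongrightarrow> f - gen P f"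
      unfolding closure_sequential by auto
    obtain v where v: "\<And>j. v j \<in> span (h ` I)" "\<And>j. v j - gen P (v j) = w j"
      using span_subset_range_resolvent[OF w(1)] by metis
    have "norm (v j - f) \<le> norm (w j - (f - gen P f))" for j
    proof -
      have "(v j - f) - gen P (v j - f) = w j - (f - gen P f)"
        unfolding gen_diff(2)[OF span_gen(1)[OF v(1)] f] v(2)[symmetric] by (simp add: algebra_simps)
      then show ?thesis
        using gen_dissipative[OF gen_diff(1)[OF span_gen(1)[OF v(1)] f], of j] by (simp only:)
    qed
    moreover have "(\<lambda>j. norm (w j - (f - gen P f))) \<longlonglongrightarrow> 0"
      using w(2) by (simp add: LIM_zero tendsto_norm_zero)
    ultimately have lim: "v \<longlonglongrightarrow> f"
      by (metis (mono_tags, lifting) LIM_zero_cancel Lim_null_comparison always_eventually)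
    have "(\<lambda>j. v j - w j) \<longlonglongrightarrow> f - (f - gen P f)"
      by (intro tendsto_diff lim w)
    moreover have "v j - w j = gen P (v j)" for j
      using v(2)[of j] by (simp add: algebra_simps)
    ultimately have "(\<lambda>j. (v j, gen P (v j))) \<longlonglongrightarrow> (f, gen P f)"
      by (intro tendsto_Pair lim) simp
    then show "(f, gen P f) \<in> closure ((\<lambda>f. (f, gen P f)) ` span (h ` I))"
      unfolding closure_sequential using v(1) by (intro exI[of _ "\<lambda>j. (v j, gen P (v j))"]) auto
  qed
qed simp

end

subsection \<open>Transition operators\<close>

lemma scaleR_fun_apply: "(r *\<^sub>R f) x = r *\<^sub>R f x"
  by (simp add: scaleR_fun_def)

lemma sum_fun_apply: "(\<Sum>i\<in>A. f i) x = (\<Sum>i\<in>A. f i x)"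
  by (induction A rule: infinite_finite_induct) auto

lemma linear_apply: "linear (\<lambda>f. f x)"
  by (rule linearI) (auto simp: scaleR_fun_apply)

lemma linear_restr: "linear (restr Z)"
  by (rule linearI) (auto simp: restr_def fun_eq_iff scaleR_fun_apply)

lemma restr_CF [simp]: "restr Z f \<in> CF Z"
  by (simp add: restr_def CF_def)

lemma restr_id [simp]: "f \<in> CF Z \<Longrightarrow> restr Z f = f"
  by (auto simp: restr_def CF_def)

lemma subspace_CF: "subspace (CF Z)"
  by (auto simp: subspace_def CF_def scaleR_fun_apply)

lemma indicator_CF: "s \<in> Z \<Longrightarrow> (indicator {s} :: _ \<Rightarrow> real) \<in> CF Z"
  by (auto simp: CF_def indicator_def)

lemma CF_decompose:
  assumes "finite Z" "f \<in> CF Z"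
  shows "f = (\<Sum>r\<in>Z. f r *\<^sub>R indicator {r})"
proof
  fix x
  have "(\<Sum>r\<in>Z. f r * indicator {r} x) = (\<Sum>r\<in>Z. if r = x then f r else 0)"
    by (intro sum.cong) auto
  then show "f x = (\<Sum>r\<in>Z. f r *\<^sub>R indicator {r}) x"
    using assms by (simp add: CF_def sum_fun_apply scaleR_fun_apply)
qed

text \<open>A transition operator is specified only on \<open>CF Z'\<close>, so it becomes linear on
  the full function type after composition with \<open>restr Z'\<close>. In this form the general
  facts on \<open>linear\<close> apply.\<close>

lemma transition_operator_linear:
  assumes "transition_operator Z' Z L"
  shows "linear (\<lambda>f. L (restr Z' f))"
proof -
  obtain \<mu> where "\<And>f. f \<in> CF Z' \<Longrightarrow> L f = restr Z (\<lambda>x. \<Sum>y\<in>Z'. \<mu> x y * f y)"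
    using assms by (auto simp: transition_operator_def)
  from this[OF restr_CF] have "L (restr Z' f) = restr Z (\<lambda>x. \<Sum>y\<in>Z'. \<mu> x y * f y)" for f
    by (simp add: restr_def)
  then show ?thesis
    by (auto intro!: linearI simp: scaleR_fun_apply restr_def fun_eq_iff sum.distrib sum_distrib_left algebra_simps)
qed

lemma transition_operator_CF:
  assumes "transition_operator Z' Z L" "f \<in> CF Z'"
  shows "L f \<in> CF Z"
  using assms by (auto simp: transition_operator_def)

lemma transition_operator_add:
  assumes "transition_operator Z' Z L" "f \<in> CF Z'" "g \<in> CF Z'"
  shows "L (f + g) = L f + L g"
  using linear_add[OF transition_operator_linear[OF assms(1)], of f g] assms(2,3)
  by (simp add: subspace_add[OF subspace_CF])

lemma transition_operator_scale:
  assumes "transition_operator Z' Z L" "f \<in> CF Z'"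
  shows "L (a *\<^sub>R f) = a *\<^sub>R L f"
  using linear_scale[OF transition_operator_linear[OF assms(1)], of a f] assms(2)
  by (simp add: subspace_scale[OF subspace_CF])

lemma transition_operator_diff:
  assumes "transition_operator Z' Z L" "f \<in> CF Z'" "g \<in> CF Z'"
  shows "L (f - g) = L f - L g"
  using linear_diff[OF transition_operator_linear[OF assms(1)], of f g] assms(2,3)
  by (simp add: subspace_diff[OF subspace_CF])

lemma transition_operator_one:
  assumes "transition_operator Z' Z L"
  shows "L (restr Z' (\<lambda>_. 1)) = restr Z (\<lambda>_. 1)"
proof -
  obtain \<mu> where \<mu>: "stochastic_matrix Z Z' \<mu>"
    and L: "\<And>f. f \<in> CF Z' \<Longrightarrow> L f = restr Z (\<lambda>x. \<Sum>y\<in>Z'. \<mu> x y * f y)"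
    using assms by (auto simp: transition_operator_def)
  show ?thesis
    unfolding L[OF restr_CF] using \<mu> by (auto simp: stochastic_matrix_def restr_def)
qed

lemma transition_operator_nonneg:
  assumes "transition_operator Z' Z L" "f \<in> CF Z'" "\<And>x. x \<in> Z' \<Longrightarrow> 0 \<le> f x"
  shows "0 \<le> L f x"
  using assms by (auto simp: transition_operator_def stochastic_matrix_def restr_def intro!: sum_nonneg)

lemma transition_operator_contraction:
  assumes "transition_operator Z' Z L" "f \<in> CF Z'" "\<And>y. y \<in> Z' \<Longrightarrow> \<bar>f y\<bar> \<le> B" "x \<in> Z"
  shows "\<bar>L f x\<bar> \<le> B"
proof -
  obtain \<mu> where \<mu>: "stochastic_matrix Z Z' \<mu>" and L: "L f = restr Z (\<lambda>x. \<Sum>y\<in>Z'. \<mu> x y * f y)"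
    using assms by (auto simp: transition_operator_def)
  have "\<bar>L f x\<bar> \<le> (\<Sum>y\<in>Z'. \<bar>\<mu> x y * f y\<bar>)"
    using assms(4) by (simp add: L restr_def)
  also have "\<dots> \<le> (\<Sum>y\<in>Z'. \<mu> x y * B)"
    using \<mu> assms(3,4) by (intro sum_mono) (auto simp: stochastic_matrix_def abs_mult intro!: mult_left_mono)
  also have "\<dots> = B"
    using \<mu> assms(4) by (simp add: stochastic_matrix_def flip: sum_distrib_right)
  finally show ?thesis .
qed

lemma transition_operator_id:
  assumes "finite Z"
  shows "transition_operator Z Z id"
  unfolding transition_operator_def stochastic_matrix_def
  using assms by (intro exI[of _ "\<lambda>x y. of_bool (x = y)"])
    (auto simp: restr_def CF_def fun_eq_iff of_bool_def if_distrib if_distribR cong: if_cong)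

lemma transition_operator_comp:
  assumes "transition_operator Z Z' L" "transition_operator Z' Z'' M"
  shows "transition_operator Z Z'' (M \<circ> L)"
proof -
  obtain \<mu> where \<mu>: "stochastic_matrix Z' Z \<mu>"
    and L: "\<And>f. f \<in> CF Z \<Longrightarrow> L f = restr Z' (\<lambda>x. \<Sum>y\<in>Z. \<mu> x y * f y)"
    using assms(1) by (auto simp: transition_operator_def)
  obtain \<nu> where \<nu>: "stochastic_matrix Z'' Z' \<nu>"
    and M: "\<And>f. f \<in> CF Z' \<Longrightarrow> M f = restr Z'' (\<lambda>x. \<Sum>y\<in>Z'. \<nu> x y * f y)"
    using assms(2) by (auto simp: transition_operator_def)
  let ?\<kappa> = "\<lambda>x z. \<Sum>y\<in>Z'. \<nu> x y * \<mu> y z"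
  \<comment> \<open>The kernel of the composition is the matrix product. This exchange of sums is
    used twice: with the constant 1 for the row sums, and with general \<open>f\<close> for the
    formula.\<close>
  have swap: "(\<Sum>z\<in>Z. ?\<kappa> x z * f z) = (\<Sum>y\<in>Z'. \<nu> x y * (\<Sum>z\<in>Z. \<mu> y z * f z))" for x f
    unfolding sum_distrib_left sum_distrib_right mult.assoc by (rule sum.swap)
  have "stochastic_matrix Z'' Z ?\<kappa>"
    using \<mu> \<nu> swap[of _ "\<lambda>_. 1"]
    by (auto simp: stochastic_matrix_def intro!: sum_nonneg)
  moreover have "(M \<circ> L) f = restr Z'' (\<lambda>x. \<Sum>z\<in>Z. ?\<kappa> x z * f z)" if "f \<in> CF Z" for f
  proof -
    have "(M \<circ> L) f = M (restr Z' (\<lambda>y. \<Sum>z\<in>Z. \<mu> y z * f z))"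
      using that by (simp add: L)
    also have "\<dots> = restr Z'' (\<lambda>x. \<Sum>z\<in>Z. ?\<kappa> x z * f z)"
      unfolding swap M[OF restr_CF] by (simp add: restr_def)
    finally show ?thesis .
  qed
  ultimately show ?thesis
    unfolding transition_operator_def by blast
qed

lemma transition_operator_funpow:
  assumes "finite Z" "transition_operator Z Z L"
  shows "transition_operator Z Z (L ^^ m)"
  using assms by (induction m) (auto intro: transition_operator_id transition_operator_comp simp flip: id_def)

lemma transition_operator_funpow_eigen:
  assumes "transition_operator Z Z L" "f \<in> CF Z" "L f = a *\<^sub>R f"
  shows "(L ^^ m) f = a ^ m *\<^sub>R f"
proof (induction m)
  case (Suc m)
  then have "(L ^^ Suc m) f = L (a ^ m *\<^sub>R f)"
    by (simp only: funpow.simps comp_apply)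
  then show ?case
    unfolding transition_operator_scale[OF assms(1,2)] assms(3) by (simp add: mult.commute[of a])
qed simp

subsection \<open>The eigenvectors of the chains\<close>

text \<open>A criterion for independence that supplies the linear maps chosen by \<open>SOME\<close>
  in \<open>Q_op\<close> and \<open>lift_o\<close>. The functionals are dual to the family up to a
  triangular error; distinct indices of equal rank do not interact. Injectivity of \<open>v\<close>
  is part of the argument, so that values can be prescribed by index.\<close>

lemma linear_extension_unitriangular:
  fixes v :: "'i \<Rightarrow> 'v::real_vector" and f :: "'i \<Rightarrow> 'w::real_vector" and rank :: "'i \<Rightarrow> 'o::linorder"
  assumes lin: "\<And>s. s \<in> J \<Longrightarrow> linear (\<phi> s :: 'v \<Rightarrow> real)"
    and diag: "\<And>s. s \<in> J \<Longrightarrow> \<phi> s (v s) = 1"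
    and upper: "\<And>r s. r \<in> J \<Longrightarrow> s \<in> J \<Longrightarrow> rank r \<le> rank s \<Longrightarrow> r \<noteq> s \<Longrightarrow> \<phi> s (v r) = 0"
  shows "\<exists>L. linear L \<and> (\<forall>s\<in>J. L (v s) = f s)"
proof -
  have inj: "inj_on v J"
  proof (rule inj_onI)
    fix r s assume rs: "r \<in> J" "s \<in> J" "v r = v s"
    consider "rank r \<le> rank s" | "rank s \<le> rank r"
      by fastforce
    then show "r = s"
      using upper[of r s] upper[of s r] diag[of r] diag[of s] rs by cases force+
  qed
  have "independent (v ` J)"
    unfolding dependent_explicit
  proof safe
    fix U u and w assume U: "finite U" "U \<subseteq> v ` J" "(\<Sum>x\<in>U. u x *\<^sub>R x) = 0" "w \<in> U" "u w \<noteq> 0"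
    \<comment> \<open>The indices with nonzero coefficient. At an element \<open>s\<close> of
      maximal rank in \<open>K\<close>, the functional \<open>\<phi> s\<close> kills every other
      term of the relation and returns the coefficient of \<open>v s\<close>, which must then
      vanish.\<close>
    define K where "K = {s \<in> J. v s \<in> U \<and> u (v s) \<noteq> 0}"
    have bij: "bij_betw v {s \<in> J. v s \<in> U} U"
      using inj U(2) by (auto simp: bij_betw_def inj_on_def)
    then have fin: "finite {s \<in> J. v s \<in> U}"
      using U(1) bij_betw_finite by blast
    then have "finite K"
      unfolding K_def by (rule rev_finite_subset) auto
    moreover have "K \<noteq> {}"
      using U by (auto simp: K_def)
    ultimately have "Max (rank ` K) \<in> rank ` K" "\<And>r. r \<in> K \<Longrightarrow> rank r \<le> Max (rank ` K)"
      by auto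
    then obtain s where s: "s \<in> K" "\<And>r. r \<in> K \<Longrightarrow> rank r \<le> rank s"
      by auto
    have sJ: "s \<in> J" "v s \<in> U" "u (v s) \<noteq> 0"
      using s(1) by (auto simp: K_def)
    have "0 = \<phi> s (\<Sum>x\<in>U. u x *\<^sub>R x)"
      using U(3) lin[OF sJ(1)] by (simp add: linear_0)
    also have "\<dots> = (\<Sum>x\<in>U. u x * \<phi> s x)"
      using lin[OF sJ(1)] by (simp add: linear_sum linear_scale)
    also have "\<dots> = (\<Sum>r | r \<in> J \<and> v r \<in> U. u (v r) * \<phi> s (v r))"
      by (rule sum.reindex_bij_betw[OF bij, symmetric])
    also have "\<dots> = (\<Sum>r | r \<in> J \<and> v r \<in> U. if r = s then u (v s) else 0)"
      using s sJ diag upper by (intro sum.cong) (auto simp: K_def)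
    also have "\<dots> = u (v s)"
      using sJ fin by simp
    finally show False
      using sJ by simp
  qed
  from linear_independent_extend[OF this, of "\<lambda>x. f (inv_into J v x)"]
  obtain L where "linear L" "\<forall>x\<in>v ` J. L x = f (inv_into J v x)"
    by (elim exE conjE)
  then show ?thesis
    using inj by (intro exI[of _ L]) simp
qed

text \<open>For \<open>i < k\<close> the coefficient of \<open>G i\<close> on the left is
  \<open>p (Suc i) * e (Suc i) - p i * e i\<close>, which the recursion turns into
  \<open>- p k * e i\<close>; for \<open>i = k\<close> only \<open>- p k * e k\<close> occurs. At
  \<open>i = 0\<close> the truncated \<open>i - 1\<close> does no harm, since
  \<open>p 0 = 0\<close>.\<close>

lemma weighted_telescope:
  fixes G :: "nat \<Rightarrow> 'v::real_vector"
  assumes "p 0 = 0" and "\<And>i. i < k \<Longrightarrow> p (Suc i) * e (Suc i) = (p i - p k) * e i"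
  shows "(\<Sum>i\<le>k. e i *\<^sub>R p i *\<^sub>R (G (i - 1) - G i)) = - p k *\<^sub>R (\<Sum>i\<le>k. e i *\<^sub>R G i)"
proof -
  \<comment> \<open>The partial sum carries the boundary term \<open>p m * e m\<close>, which at
    \<open>m = k\<close> becomes the last summand of the right-hand side.\<close>
  have "(\<Sum>i\<le>m. e i *\<^sub>R p i *\<^sub>R (G (i - 1) - G i)) =
      - p k *\<^sub>R (\<Sum>i<m. e i *\<^sub>R G i) - (p m * e m) *\<^sub>R G m" if "m \<le> k" for m
    using that
  proof (induction m)
    case (Suc m)
    have "e (Suc m) *\<^sub>R p (Suc m) *\<^sub>R (G m - G (Suc m)) =
        ((p m - p k) * e m) *\<^sub>R G m - (p (Suc m) * e (Suc m)) *\<^sub>R G (Suc m)"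
      unfolding assms(2)[OF Suc_le_lessD[OF Suc.prems], symmetric] by (simp add: algebra_simps)
    then have "(\<Sum>i\<le>Suc m. e i *\<^sub>R p i *\<^sub>R (G (i - 1) - G i)) =
        (- p k *\<^sub>R (\<Sum>i<m. e i *\<^sub>R G i) - (p m * e m) *\<^sub>R G m) +
        (((p m - p k) * e m) *\<^sub>R G m - (p (Suc m) * e (Suc m)) *\<^sub>R G (Suc m))"
      using Suc by simp
    then show ?case
      by (simp only:) (simp add: algebra_simps)
  qed (simp add: assms)
  from this[of k] show ?thesis
    by (simp add: algebra_simps flip: lessThan_Suc_atMost)
qed

section \<open>Chains with down-operators: the relations (A0)-(A5) on each level\<close>

locale up_down_system =
  fixes S :: "nat \<Rightarrow> 'a set"
    and c :: "nat \<Rightarrow> real"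
    and T D :: "nat \<Rightarrow> ('a \<Rightarrow> real) \<Rightarrow> 'a \<Rightarrow> real"
  assumes finite_S: "finite (S n)"
    and disjoint_S: "m \<noteq> n \<Longrightarrow> S m \<inter> S n = {}"
    and root: "\<exists>r. S 0 = {r}"
    and T_transition: "transition_operator (S n) (S n) (T n)"
    and c_pos: "0 < c n"
    and c_less_Suc: "c n < c (Suc n)"
    and D_transition: "transition_operator (S n) (S (Suc n)) (D (Suc n))"
    and range_shifted_gen: "(\<lambda>f. chain_gen c T (Suc n) f + c n *\<^sub>R f) ` CF (S (Suc n)) \<subseteq> D (Suc n) ` CF (S n)"
    and D_inj: "inj_on (D (Suc n)) (CF (S n))"
    and intertwining: "f \<in> CF (S n) \<Longrightarrow> chain_gen c T (Suc n) (D (Suc n) f) = D (Suc n) (chain_gen c T n f)"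
begin

abbreviation "A \<equiv> chain_gen c T"
abbreviation "d \<equiv> d_fun S D"
abbreviation "h \<equiv> h_fun S c T D"
abbreviation "U \<equiv> up_op S c T D"

lemma level_eq: "s \<in> S n \<Longrightarrow> level S s = n"
  unfolding level_def using disjoint_S by blast

lemma states_iff: "s \<in> states S \<longleftrightarrow> s \<in> S (level S s)"
  using level_eq by (auto simp: states_def)

lemma A_linear: "linear (\<lambda>f. A n (restr (S n) f))"
  unfolding chain_gen_def
  by (intro linear_compose_scale_right linear_compose_sub transition_operator_linear[OF T_transition] linear_restr)

text \<open>A stochastic matrix on a single point is the identity. This is what ends the chain of
  relations between the levels at the root.\<close>

lemma A_root:
  assumes "f \<in> CF (S 0)"
  shows "A 0 f = 0"
proof -
  obtain r where "S 0 = {r}"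
    using root by blast
  then have "T 0 f = f"
    using T_transition[of 0] assms
    by (auto simp: transition_operator_def stochastic_matrix_def restr_def CF_def fun_eq_iff)
  then show ?thesis
    by (simp add: chain_gen_def)
qed

definition down :: "nat \<Rightarrow> nat \<Rightarrow> ('a \<Rightarrow> real) \<Rightarrow> 'a \<Rightarrow> real"
  where "down k n = fold D [Suc k..<Suc n]"

lemma down_refl [simp]: "down k k = id"
  by (simp add: down_def)

lemma down_Suc: "k \<le> n \<Longrightarrow> down k (Suc n) = D (Suc n) \<circ> down k n"
  by (simp add: down_def)

lemma down_Suc_left:
  assumes "k < n"
  shows "down k n = down (Suc k) n \<circ> D (Suc k)"
proof -
  have "[Suc k..<Suc n] = Suc k # [Suc (Suc k)..<Suc n]"
    using assms by (intro upt_conv_Cons) simp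
  then show ?thesis
    by (simp only: down_def fold_Cons)
qed

lemma down_transition: "k \<le> n \<Longrightarrow> transition_operator (S k) (S n) (down k n)"
proof (induction n rule: dec_induct)
  case base
  show ?case
    by (simp only: down_refl transition_operator_id[OF finite_S])
next
  case (step n)
  then show ?case
    using transition_operator_comp[OF step.IH D_transition] by (simp only: down_Suc)
qed

lemma A_down:
  assumes "k \<le> n" "f \<in> CF (S k)"
  shows "A n (down k n f) = down k n (A k f)"
  using assms
proof (induction n rule: dec_induct)
  case (step n)
  then show ?case
    using intertwining[OF transition_operator_CF[OF down_transition]] by (simp add: down_Suc)
qed simp

text \<open>Turns the global function \<open>d s\<close> into an iterated down-operator on level
  \<open>n\<close>, where the operator identities are available.\<close>

lemma restr_d:
  assumes "s \<in> S k"
  shows "restr (S n) (d s) = (if k \<le> n then down k n (indicator {s}) else 0)"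
proof (cases "k \<le> n")
  case True
  have "down k n (indicator {s}) \<in> CF (S n)"
    using True assms by (intro transition_operator_CF[OF down_transition] indicator_CF)
  moreover have "d s u = down k n (indicator {s}) u" if "u \<in> S n" for u
    using that True level_eq[OF assms] level_eq[OF that]
    by (auto simp: d_fun_def down_def states_def simp del: upt_Suc)
  ultimately show ?thesis
    using True by (auto simp: restr_def fun_eq_iff CF_def)
next
  case False
  then show ?thesis
    using level_eq[OF assms] by (auto simp: restr_def d_fun_def fun_eq_iff level_eq)
qed

lemma U_props:
  assumes "f \<in> CF (S (Suc n))"
  shows "U n f \<in> CF (S n)"
    and "c n *\<^sub>R D (Suc n) (U n f) = A (Suc n) f + c n *\<^sub>R f"
proof -
  have D_scale: "D (Suc n) (a *\<^sub>R g) = a *\<^sub>R D (Suc n) g" if "g \<in> CF (S n)" for a g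
    by (rule transition_operator_scale[OF D_transition that])
  have "A (Suc n) f + c n *\<^sub>R f \<in> D (Suc n) ` CF (S n)"
    using range_shifted_gen assms by (rule subsetD[OF _ imageI])
  then obtain g where g: "g \<in> CF (S n)" "A (Suc n) f + c n *\<^sub>R f = D (Suc n) g"
    by blast
  have "\<exists>!g. g \<in> CF (S n) \<and> c n *\<^sub>R D (Suc n) g = A (Suc n) f + c n *\<^sub>R f"
  proof (rule ex1I)
    \<comment> \<open>(A3) provides \<open>g\<close> without the factor \<open>c n\<close>, so the
      value sought is \<open>g\<close> divided by \<open>c n\<close>.\<close>
    have "c n *\<^sub>R D (Suc n) (inverse (c n) *\<^sub>R g) = (c n * inverse (c n)) *\<^sub>R D (Suc n) g"
      using D_scale[OF g(1)] by simp
    then show "inverse (c n) *\<^sub>R g \<in> CF (S n) \<and>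
        c n *\<^sub>R D (Suc n) (inverse (c n) *\<^sub>R g) = A (Suc n) f + c n *\<^sub>R f"
      using g c_pos[of n] by (simp add: subspace_scale[OF subspace_CF])
  next
    fix g' assume g': "g' \<in> CF (S n) \<and> c n *\<^sub>R D (Suc n) g' = A (Suc n) f + c n *\<^sub>R f"
    then have "D (Suc n) (c n *\<^sub>R g') = D (Suc n) g"
      using g(2) D_scale by metis
    then have "c n *\<^sub>R g' = g"
      using inj_onD[OF D_inj _ subspace_scale[OF subspace_CF] g(1)] g' by simp
    then show "g' = inverse (c n) *\<^sub>R g"
      using c_pos[of n] by auto
  qed
  from theI'[OF this]
  show "U n f \<in> CF (S n)" "c n *\<^sub>R D (Suc n) (U n f) = A (Suc n) f + c n *\<^sub>R f"
    unfolding up_op_def by blast+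
qed

text \<open>As a function of its last argument this is the column
  \<open>p_up S c T D i k _ s\<close> of the up-kernel, with the target state \<open>s\<close>
  fixed.\<close>

definition up :: "nat \<Rightarrow> nat \<Rightarrow> 'a \<Rightarrow> 'a \<Rightarrow> real"
  where "up i k s = foldr U [i..<k] (indicator {s})"

lemma up_refl [simp]: "up k k s = indicator {s}"
  by (simp add: up_def)

lemma up_step: "i < k \<Longrightarrow> up i k s = U i (up (Suc i) k s)"
  by (simp add: up_def upt_conv_Cons)

lemma up_CF:
  assumes "i \<le> k" "s \<in> S k"
  shows "up i k s \<in> CF (S i)"
  using assms by (induction i rule: inc_induct) (simp_all add: indicator_CF up_step U_props(1))

text \<open>The generator moves through the down-operators to level \<open>i = Suc j\<close>. There
  the equation defining \<open>U j\<close> reads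
  \<open>A i F = c j *\<^sub>R (D i (U j F) - F)\<close>, and the new \<open>D i\<close> is absorbed
  into \<open>down j n\<close>. For \<open>i = 0\<close> both sides vanish, the left one by
  \<open>A_root\<close>.\<close>

lemma A_down_up:
  assumes "i \<le> k" "k \<le> n" "s \<in> S k"
  shows "A n (down i n (up i k s)) =
    cpred c i *\<^sub>R (down (i - 1) n (up (i - 1) k s) - down i n (up i k s))"
proof (cases i)
  case 0
  \<comment> \<open>Zero is written as a restriction because \<open>down i n\<close> is known to be
    linear only after \<open>restr (S i)\<close>.\<close>
  have "A n (down i n (up i k s)) = down i n (restr (S i) 0)"
    using assms 0 restr_id[OF subspace_0[OF subspace_CF[of "S 0"]]] by (simp add: A_down A_root up_CF)
  also have "\<dots> = 0"
    using assms by (intro linear_0[OF transition_operator_linear[OF down_transition]]) simp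
  finally show ?thesis
    using 0 by (simp add: cpred_def)
next
  case (Suc j)
  have up: "up i k s \<in> CF (S (Suc j))" "up j k s \<in> CF (S j)" "up j k s = U j (up i k s)"
    using assms Suc up_CF[of i k s] up_CF[of j k s] up_step[of j k s] by auto
  have tr: "transition_operator (S (Suc j)) (S n) (down i n)"
    using down_transition[of i n] assms Suc by simp
  have D: "D (Suc j) (up j k s) \<in> CF (S (Suc j))"
    by (rule transition_operator_CF[OF D_transition up(2)])
  have "A (Suc j) (up i k s) = c j *\<^sub>R D (Suc j) (up j k s) - c j *\<^sub>R up i k s"
    using U_props(2)[OF up(1)] up(3) by simp
  also have "\<dots> = c j *\<^sub>R (D (Suc j) (up j k s) - up i k s)"
    by (simp add: scaleR_diff_right)
  finally have "A n (down i n (up i k s)) = down i n (c j *\<^sub>R (D (Suc j) (up j k s) - up i k s))"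
    using A_down[of i n "up i k s"] assms up(1) Suc by simp
  also have "\<dots> = c j *\<^sub>R (down i n (D (Suc j) (up j k s)) - down i n (up i k s))"
    using transition_operator_scale[OF tr] transition_operator_diff[OF tr] D up(1)
    by (simp add: subspace_diff[OF subspace_CF])
  also have "down i n (D (Suc j) (up j k s)) = down j n (up j k s)"
    using down_Suc_left[of j n] assms Suc by simp
  finally show ?thesis
    by (simp only: Suc cpred_def nat.case diff_Suc_1)
qed

lemma c_strict_mono: "strict_mono c"
  using c_less_Suc by (simp add: strict_mono_Suc_iff)

lemma cpred_less: "i < k \<Longrightarrow> cpred c i < cpred c k"
  using c_pos c_strict_mono by (auto simp: cpred_def strict_mono_def split: nat.splits)

lemma cpred_nonneg: "0 \<le> cpred c i"
  using c_pos by (auto simp: cpred_def less_imp_le split: nat.splits)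

lemma eta_refl [simp]: "eta c k k = 1"
  by (simp add: eta_def)

text \<open>The factor of the product at \<open>m = i\<close> has numerator
  \<open>c i = cpred c (Suc i)\<close> and denominator \<open>cpred c i - cpred c k\<close>, nonzero
  by strict monotonicity. This is the recursion demanded by
  \<open>weighted_telescope\<close>.\<close>

lemma eta_Suc:
  assumes "i < k"
  shows "cpred c (Suc i) * eta c (Suc i) k = (cpred c i - cpred c k) * eta c i k"
  using cpred_less[OF assms] assms
  by (simp add: eta_def prod.atLeast_Suc_lessThan cpred_def[of c "Suc i"])

lemma h_eq:
  assumes "s \<in> S k"
  shows "h s = (\<Sum>i\<le>k. \<Sum>r\<in>S i. (up i k s r * eta c i k) *\<^sub>R d r)"
proof -
  have "{r \<in> states S. level S r \<le> level S s} = (\<Union>i\<in>{..k}. S i)"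
    using level_eq assms by (fastforce simp: states_def)
  then have "h s = (\<Sum>r\<in>(\<Union>i\<in>{..k}. S i). (up (level S r) k s r * eta c (level S r) k) *\<^sub>R d r)"
    using level_eq[OF assms] by (simp add: h_fun_def p_up_def up_def)
  also have "\<dots> = (\<Sum>i\<le>k. \<Sum>r\<in>S i. (up (level S r) k s r * eta c (level S r) k) *\<^sub>R d r)"
    using finite_S disjoint_S by (intro sum.UNION_disjoint) auto
  also have "\<dots> = (\<Sum>i\<le>k. \<Sum>r\<in>S i. (up i k s r * eta c i k) *\<^sub>R d r)"
    using level_eq by (intro sum.cong) auto
  finally show ?thesis .
qed

text \<open>On level \<open>n\<close> the sum over \<open>S i\<close> reassembles
  \<open>up i k s\<close> from its values times indicators, by linearity of \<open>down i n\<close>.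
  What is left is one weighted term per level.\<close>

lemma restr_h:
  assumes "s \<in> S k" "k \<le> n"
  shows "restr (S n) (h s) = (\<Sum>i\<le>k. eta c i k *\<^sub>R down i n (up i k s))"
proof -
  have "restr (S n) (h s) = (\<Sum>i\<le>k. \<Sum>r\<in>S i. (up i k s r * eta c i k) *\<^sub>R restr (S n) (d r))"
    unfolding h_eq[OF assms(1)] by (simp only: linear_sum[OF linear_restr] linear_scale[OF linear_restr])
  also have "\<dots> = (\<Sum>i\<le>k. eta c i k *\<^sub>R down i n (up i k s))"
  proof (rule sum.cong)
    fix i assume i: "i \<in> {..k}"
    then have tr: "transition_operator (S i) (S n) (down i n)"
      using assms by (intro down_transition) simp
    note lin = transition_operator_linear[OF tr]
    have "(\<Sum>r\<in>S i. (up i k s r * eta c i k) *\<^sub>R restr (S n) (d r)) =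
        (\<Sum>r\<in>S i. eta c i k *\<^sub>R up i k s r *\<^sub>R down i n (indicator {r}))"
      using i assms by (intro sum.cong) (auto simp: restr_d mult.commute)
    also have "\<dots> = eta c i k *\<^sub>R (\<Sum>r\<in>S i. up i k s r *\<^sub>R down i n (restr (S i) (indicator {r})))"
      unfolding scaleR_sum_right by (intro sum.cong) (simp_all only: restr_id[OF indicator_CF])
    also have "(\<Sum>r\<in>S i. up i k s r *\<^sub>R down i n (restr (S i) (indicator {r}))) =
        down i n (restr (S i) (\<Sum>r\<in>S i. up i k s r *\<^sub>R indicator {r}))"
      by (simp only: linear_sum[OF lin] linear_scale[OF lin])
    also have "(\<Sum>r\<in>S i. up i k s r *\<^sub>R indicator {r}) = up i k s"
      using i assms by (intro CF_decompose[symmetric] finite_S up_CF) auto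
    also have "restr (S i) (up i k s) = up i k s"
      using i assms by (intro restr_id up_CF) auto
    finally show "(\<Sum>r\<in>S i. (up i k s r * eta c i k) *\<^sub>R restr (S n) (d r)) = eta c i k *\<^sub>R down i n (up i k s)" .
  qed simp
  finally show ?thesis .
qed

lemma A_h:
  assumes "s \<in> S k" "k \<le> n"
  shows "A n (restr (S n) (h s)) = - cpred c k *\<^sub>R restr (S n) (h s)"
proof -
  have "A n (restr (S n) (h s)) = A n (restr (S n) (\<Sum>i\<le>k. eta c i k *\<^sub>R down i n (up i k s)))"
    by (simp only: restr_h[OF assms, symmetric] restr_id[OF restr_CF])
  also have "\<dots> = (\<Sum>i\<le>k. eta c i k *\<^sub>R A n (restr (S n) (down i n (up i k s))))"
    by (simp only: linear_sum[OF A_linear] linear_scale[OF A_linear])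
  also have "\<dots> = (\<Sum>i\<le>k. eta c i k *\<^sub>R A n (down i n (up i k s)))"
  proof (rule sum.cong)
    fix i assume "i \<in> {..k}"
    then have "down i n (up i k s) \<in> CF (S n)"
      using assms by (intro transition_operator_CF[OF down_transition] up_CF) auto
    then show "eta c i k *\<^sub>R A n (restr (S n) (down i n (up i k s))) = eta c i k *\<^sub>R A n (down i n (up i k s))"
      by (simp only: restr_id)
  qed simp
  also have "\<dots> = (\<Sum>i\<le>k. eta c i k *\<^sub>R cpred c i *\<^sub>R (down (i - 1) n (up (i - 1) k s) - down i n (up i k s)))"
    using assms by (intro sum.cong) (simp_all only: A_down_up atMost_iff)
  also have "\<dots> = - cpred c k *\<^sub>R (\<Sum>i\<le>k. eta c i k *\<^sub>R down i n (up i k s))"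
    \<comment> \<open>Here \<open>p\<close> is \<open>cpred c\<close> and \<open>e\<close> is
      \<open>\<lambda>i. eta c i k\<close>.\<close>
    by (rule weighted_telescope[where G = "\<lambda>i. down i n (up i k s)"])
       (simp_all only: eta_Suc, simp add: cpred_def)
  finally show ?thesis
    by (simp only: restr_h[OF assms])
qed

lemma T_h:
  assumes "s \<in> S k" "k \<le> n"
  shows "T n (restr (S n) (h s)) = (1 - cpred c k / c n) *\<^sub>R restr (S n) (h s)"
proof -
  let ?f = "restr (S n) (h s)"
  have "c n *\<^sub>R (T n ?f - ?f) = - cpred c k *\<^sub>R ?f"
    using A_h[OF assms] by (simp only: chain_gen_def)
  then have "inverse (c n) *\<^sub>R c n *\<^sub>R (T n ?f - ?f) = inverse (c n) *\<^sub>R - cpred c k *\<^sub>R ?f"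
    by (simp only:)
  then have "T n ?f - ?f = - (cpred c k / c n) *\<^sub>R ?f"
    using c_pos[of n] by (simp only: scaleR_scaleR) (simp add: divide_inverse mult.commute)
  then have "T n ?f = ?f + - (cpred c k / c n) *\<^sub>R ?f"
    by (simp only: diff_eq_eq add.commute)
  then show ?thesis
    by (simp only: scaleR_diff_left scaleR_one scaleR_minus_left) simp
qed

lemma T_funpow_h:
  assumes "s \<in> S k" "k \<le> n"
  shows "(T n ^^ m) (restr (S n) (h s)) = (1 - cpred c k / c n) ^ m *\<^sub>R restr (S n) (h s)"
  by (rule transition_operator_funpow_eigen[OF T_transition restr_CF T_h[OF assms]])

section \<open>Triangularity and independence of the two families\<close>

lemma d_diag:
  assumes "r \<in> states S" "s \<in> states S" "level S s \<le> level S r"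
  shows "d r s = (if r = s then 1 else 0)"
  using assms by (cases "level S s = level S r") (auto simp: d_fun_def)

text \<open>The functionals are evaluations at states. The rank is the negated level, because
  \<open>d r\<close> vanishes at all states other than \<open>r\<close> whose level is at most that
  of \<open>r\<close>.\<close>

lemma d_extension: "\<exists>L. linear L \<and> (\<forall>s\<in>states S. L (d s) = f s)"
  by (rule linear_extension_unitriangular[where \<phi> = "\<lambda>s f. f s" and rank = "\<lambda>s. - int (level S s)"])
     (auto simp: linear_apply d_diag)

text \<open>The functional \<open>\<phi> s\<close> reads off the coefficient of \<open>d s\<close>.
  In \<open>h r\<close> the vector \<open>d r\<close> has coefficient 1, since
  \<open>up k k r\<close> is an indicator and \<open>eta c k k = 1\<close>; all other terms have
  lower level. So here the level itself is the rank.\<close>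

lemma h_extension: "\<exists>L. linear L \<and> (\<forall>s\<in>states S. L (h s) = f s)"
proof -
  obtain \<phi> :: "'a \<Rightarrow> ('a \<Rightarrow> real) \<Rightarrow> real"
    where lin: "\<And>s. linear (\<phi> s)" and \<phi>: "\<And>s r. r \<in> states S \<Longrightarrow> \<phi> s (d r) = indicator {s} r"
    using d_extension[of "indicator {s} :: 'a \<Rightarrow> real" for s] by metis
  have \<phi>_h: "\<phi> s (h r) = (if r = s then 1 else 0)"
    if "r \<in> states S" "s \<in> states S" "level S r \<le> level S s" for r s
  proof -
    let ?k = "level S r"
    have r: "r \<in> S ?k"
      using that by (simp add: states_iff)
    have "\<phi> s (h r) = (\<Sum>i\<le>?k. \<Sum>q\<in>S i. (up i ?k r q * eta c i ?k) * \<phi> s (d q))"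
      unfolding h_eq[OF r] by (simp add: linear_sum[OF lin] linear_scale[OF lin])
    also have "\<dots> = (\<Sum>i\<le>?k. if i = ?k then if r = s then 1 else 0 else 0)"
    proof (intro sum.cong refl)
      fix i assume i: "i \<in> {..?k}"
      have st: "q \<in> states S" if "q \<in> S i" for q
        using that by (auto simp: states_def)
      have "(\<Sum>q\<in>S i. (up i ?k r q * eta c i ?k) * \<phi> s (d q)) =
          (\<Sum>q\<in>S i. if q = s then up i ?k r s * eta c i ?k else 0)"
        by (intro sum.cong) (auto simp: \<phi>[OF st])
      also have "\<dots> = (if s \<in> S i then up i ?k r s * eta c i ?k else 0)"
        by (simp add: finite_S)
      also have "\<dots> = (if i = ?k then if r = s then 1 else 0 else 0)"
      proof (cases "i = ?k")
        case True
        then show ?thesis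
          using that r by (auto simp: indicator_def)
      next
        case False
        then have "s \<notin> S i"
          using i that level_eq[of s i] by auto
        then show ?thesis
          using False by simp
      qed
      finally show "(\<Sum>q\<in>S i. (up i ?k r q * eta c i ?k) * \<phi> s (d q)) =
          (if i = ?k then if r = s then 1 else 0 else 0)" .
    qed
    finally show ?thesis
      by simp
  qed
  show ?thesis
    by (rule linear_extension_unitriangular[where \<phi> = \<phi> and rank = "level S"])
       (simp_all add: lin \<phi>_h)
qed

text \<open>The relation between the families is unitriangular in the level: solving the formula for
  \<open>h s\<close> for its top term expresses \<open>d s\<close> by \<open>h s\<close> and
  functions \<open>d r\<close> of lower level.\<close>

lemma span_h: "span (h ` states S) = span (d ` states S)"
proof (rule antisym)
  show "span (h ` states S) \<subseteq> span (d ` states S)"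
  proof (rule span_minimal)
    show "h ` states S \<subseteq> span (d ` states S)"
    proof safe
      fix s assume s: "s \<in> states S"
      show "h s \<in> span (d ` states S)"
        unfolding h_eq[OF s[unfolded states_iff]]
        by (intro span_sum span_scale span_base) (auto simp: states_def)
    qed
  qed simp
  have "d s \<in> span (h ` states S)" if "s \<in> S k" for k s
    using that
  proof (induction k arbitrary: s rule: less_induct)
    case (less k)
    have "h s = (\<Sum>i<k. \<Sum>r\<in>S i. (up i k s r * eta c i k) *\<^sub>R d r)
        + (\<Sum>r\<in>S k. indicator {s} r *\<^sub>R d r)"
      unfolding h_eq[OF less.prems] by (simp flip: lessThan_Suc_atMost)
    also have "(\<Sum>r\<in>S k. indicator {s} r *\<^sub>R d r) = (\<Sum>r\<in>S k. if r = s then d r else 0)"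
      by (intro sum.cong) (auto simp: indicator_def)
    also have "\<dots> = d s"
      using less.prems finite_S by simp
    finally have "d s = h s - (\<Sum>i<k. \<Sum>r\<in>S i. (up i k s r * eta c i k) *\<^sub>R d r)"
      by (simp only: add_diff_cancel_left')
    also have "\<dots> \<in> span (h ` states S)"
      using less
      by (intro span_diff span_sum span_scale) (auto simp: states_def intro: span_base)
    finally show ?case .
  qed
  then show "span (d ` states S) \<subseteq> span (h ` states S)"
    by (intro span_minimal) (auto simp: states_def)
qed

end

subsection \<open>Convergence along the levels\<close>

lemma abs_le_sup_norm:
  assumes "finite Z" "x \<in> Z"
  shows "\<bar>f x\<bar> \<le> sup_norm Z f"
  unfolding sup_norm_def using assms by (intro cSUP_upper) auto

lemma sup_norm_le:
  assumes "Z \<noteq> {}" "\<And>x. x \<in> Z \<Longrightarrow> \<bar>f x\<bar> \<le> B"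
  shows "sup_norm Z f \<le> B"
  unfolding sup_norm_def using assms by (intro cSUP_least) auto

lemma proj_CF: "proj S \<iota> n f \<in> CF (S n)"
  by (simp add: proj_def)

lemma proj_add: "proj S \<iota> n (f + g) = proj S \<iota> n f + proj S \<iota> n g"
  by (auto simp: proj_def restr_def fun_eq_iff)

lemma proj_scale: "proj S \<iota> n (a *\<^sub>R f) = a *\<^sub>R proj S \<iota> n f"
  by (auto simp: proj_def restr_def fun_eq_iff scaleR_fun_apply)

lemma proj_apply: "x \<in> S n \<Longrightarrow> proj S \<iota> n f x = apply_bcontfun f (\<iota> x)"
  by (simp add: proj_def restr_def)

lemma abs_apply_bcontfun_le: "\<bar>apply_bcontfun f x\<bar> \<le> norm f" for f :: "'e::metric_space \<Rightarrow>\<^sub>C real"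
  using norm_bounded[of f x] by simp

locale dense_levels =
  fixes S :: "nat \<Rightarrow> 'a set" and \<iota> :: "'a \<Rightarrow> 'e::metric_space"
  assumes finite_levels: "finite (S n)"
    and dense_levels: "\<exists>s. (\<forall>n. s n \<in> S n) \<and> (\<lambda>n. \<iota> (s n)) \<longlonglongrightarrow> x"
begin

abbreviation "conv \<equiv> conv_to S \<iota>"
abbreviation "\<pi> \<equiv> proj S \<iota>"

lemma \<pi>_CF: "\<pi> n f \<in> CF (S n)"
  by (rule proj_CF)

text \<open>A type is inhabited, so (L1) applied to any point of it yields a state on every level.
  This is needed for \<open>sup_norm\<close>, as a supremum over no states would not be
  meaningful.\<close>

lemma levels_nonempty: "S n \<noteq> {}"
  using dense_levels by blast

text \<open>The working form of convergence: all later estimates are pointwise on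
  \<open>S n\<close>, and the non-strict bound lets them avoid suprema.\<close>

lemma conv_iff:
  "conv F f \<longleftrightarrow> (\<forall>e>0. \<forall>\<^sub>F n in sequentially. \<forall>x\<in>S n. \<bar>F n x - apply_bcontfun f (\<iota> x)\<bar> \<le> e)"
proof -
  define N where "N = (\<lambda>n. sup_norm (S n) (F n - \<pi> n f))"
  have eq: "(F n - \<pi> n f) x = F n x - apply_bcontfun f (\<iota> x)" if "x \<in> S n" for n x
    using that by (simp add: proj_apply)
  have le: "N n \<le> e \<longleftrightarrow> (\<forall>x\<in>S n. \<bar>F n x - apply_bcontfun f (\<iota> x)\<bar> \<le> e)" for n e
  proof
    show "\<forall>x\<in>S n. \<bar>F n x - apply_bcontfun f (\<iota> x)\<bar> \<le> e" if "N n \<le> e"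
      using that eq abs_le_sup_norm[OF finite_levels, of _ n "F n - \<pi> n f"]
      unfolding N_def by fastforce
    show "N n \<le> e" if "\<forall>x\<in>S n. \<bar>F n x - apply_bcontfun f (\<iota> x)\<bar> \<le> e"
      unfolding N_def using that eq by (intro sup_norm_le[OF levels_nonempty]) simp
  qed
  have nonneg: "0 \<le> N n" for n
    unfolding N_def using levels_nonempty abs_le_sup_norm[OF finite_levels]
    by (meson abs_ge_zero all_not_in_conv order_trans)
  have "conv F f \<longleftrightarrow> (\<forall>e>0. \<forall>\<^sub>F n in sequentially. N n < e)"
    using nonneg unfolding conv_to_def N_def[symmetric] by (simp add: tendsto_iff)
  also have "\<dots> \<longleftrightarrow> (\<forall>e>0. \<forall>\<^sub>F n in sequentially. N n \<le> e)"
  proof safe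
    fix e :: real assume "\<forall>e>0. \<forall>\<^sub>F n in sequentially. N n < e" "0 < e"
    then show "\<forall>\<^sub>F n in sequentially. N n \<le> e"
      by (auto elim!: allE[of _ e] eventually_mono)
  next
    fix e :: real assume *: "\<forall>e>0. \<forall>\<^sub>F n in sequentially. N n \<le> e" and "0 < e"
    from *[rule_format, of "e / 2"] have "\<forall>\<^sub>F n in sequentially. N n \<le> e / 2"
      using \<open>0 < e\<close> by (simp only: half_gt_zero_iff)
    then show "\<forall>\<^sub>F n in sequentially. N n < e"
      by (rule eventually_mono) (use \<open>0 < e\<close> in simp)
  qed
  finally show ?thesis
    by (simp only: le)
qed

lemma conv_eventually:
  assumes "conv F f" "0 < e"
  shows "\<forall>\<^sub>F n in sequentially. \<forall>x\<in>S n. \<bar>F n x - apply_bcontfun f (\<iota> x)\<bar> \<le> e"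
  using assms unfolding conv_iff by blast

text \<open>Along states from (L1), closeness of \<open>F n\<close> to \<open>f\<close> on
  \<open>S n\<close> combines with continuity of \<open>f\<close> at \<open>x\<close>. Uniqueness of
  limits, the norm bound and positivity are all passed to the limit space through this
  lemma.\<close>

lemma conv_pointwise:
  assumes "conv F f" "\<And>n. s n \<in> S n" "(\<lambda>n. \<iota> (s n)) \<longlonglongrightarrow> x"
  shows "(\<lambda>n. F n (s n)) \<longlonglongrightarrow> apply_bcontfun f x"
proof -
  have "isCont (apply_bcontfun f) x"
    using continuous_on_apply_bcontfun continuous_on_eq_continuous_at[OF open_UNIV] by blast
  then have "(\<lambda>n. apply_bcontfun f (\<iota> (s n))) \<longlonglongrightarrow> apply_bcontfun f x"
    using assms(3) by (rule isCont_tendsto_compose)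
  moreover have "(\<lambda>n. F n (s n) - apply_bcontfun f (\<iota> (s n))) \<longlonglongrightarrow> 0"
  proof (rule tendstoI)
    fix e :: real assume "0 < e"
    then have "\<forall>\<^sub>F n in sequentially. \<forall>x\<in>S n. \<bar>F n x - apply_bcontfun f (\<iota> x)\<bar> \<le> e / 2"
      by (intro conv_eventually assms(1)) simp
    then show "\<forall>\<^sub>F n in sequentially. dist (F n (s n) - apply_bcontfun f (\<iota> (s n))) 0 < e"
      by (rule eventually_mono) (use assms(2) \<open>0 < e\<close> in \<open>force simp: dist_norm\<close>)
  qed
  ultimately show ?thesis
    using tendsto_add by fastforce
qed

lemma conv_unique:
  assumes "conv F f" "conv F g"
  shows "f = g"
proof (rule bcontfun_eqI)
  fix x
  obtain s where s: "\<And>n. s n \<in> S n" "(\<lambda>n. \<iota> (s n)) \<longlonglongrightarrow> x"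
    using dense_levels by blast
  show "apply_bcontfun f x = apply_bcontfun g x"
    by (rule LIMSEQ_unique[OF conv_pointwise[OF assms(1) s] conv_pointwise[OF assms(2) s]])
qed

lemma conv_cong:
  assumes "conv F f" "\<forall>\<^sub>F n in sequentially. G n = F n"
  shows "conv G f"
  unfolding conv_iff
proof safe
  fix e :: real assume "0 < e"
  then have "\<forall>\<^sub>F n in sequentially. \<forall>x\<in>S n. \<bar>F n x - apply_bcontfun f (\<iota> x)\<bar> \<le> e"
    by (intro conv_eventually assms(1))
  with assms(2) show "\<forall>\<^sub>F n in sequentially. \<forall>x\<in>S n. \<bar>G n x - apply_bcontfun f (\<iota> x)\<bar> \<le> e"
    by eventually_elim simp
qed

lemma conv_add:
  assumes "conv F f" "conv G g"
  shows "conv (\<lambda>n. F n + G n) (f + g)"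
  unfolding conv_iff
proof safe
  fix e :: real assume "0 < e"
  then have "\<forall>\<^sub>F n in sequentially. \<forall>x\<in>S n. \<bar>F n x - apply_bcontfun f (\<iota> x)\<bar> \<le> e / 2"
    "\<forall>\<^sub>F n in sequentially. \<forall>x\<in>S n. \<bar>G n x - apply_bcontfun g (\<iota> x)\<bar> \<le> e / 2"
    by (intro conv_eventually assms; simp)+
  then show "\<forall>\<^sub>F n in sequentially. \<forall>x\<in>S n. \<bar>(F n + G n) x - apply_bcontfun (f + g) (\<iota> x)\<bar> \<le> e"
  proof eventually_elim
    case (elim n)
    show ?case
    proof
      fix x assume "x \<in> S n"
      then have "\<bar>F n x - apply_bcontfun f (\<iota> x)\<bar> \<le> e / 2" "\<bar>G n x - apply_bcontfun g (\<iota> x)\<bar> \<le> e / 2"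
        using elim by auto
      then show "\<bar>(F n + G n) x - apply_bcontfun (f + g) (\<iota> x)\<bar> \<le> e"
        unfolding plus_fun_apply plus_bcontfun.rep_eq by linarith
    qed
  qed
qed

text \<open>The scalars may vary with \<open>n\<close>, as the eigenvalue powers on level
  \<open>n\<close> do.\<close>

lemma conv_scale:
  assumes "conv F f" "a \<longlonglongrightarrow> b"
  shows "conv (\<lambda>n. a n *\<^sub>R F n) (b *\<^sub>R f)"
  unfolding conv_iff
proof safe
  fix e :: real assume e: "0 < e"
  \<comment> \<open>\<open>K\<close> bounds \<open>\<bar>a n\<bar>\<close> as soon as
    \<open>a n\<close> is within 1 of \<open>b\<close>, and \<open>M\<close> bounds
    \<open>f\<close>; the added 1 keeps both positive. They balance the two terms of the splitting
    \<open>a n * (F n - f) + (a n - b) * f\<close>.\<close>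
  define K where "K = \<bar>b\<bar> + 1"
  have K: "0 < K"
    by (simp add: K_def add_nonneg_pos)
  define M where "M = norm f + 1"
  have M: "0 < M"
    by (simp add: M_def add_nonneg_pos)
  have "\<forall>\<^sub>F n in sequentially. \<forall>x\<in>S n. \<bar>F n x - apply_bcontfun f (\<iota> x)\<bar> \<le> e / (2 * K)"
    using e K by (intro conv_eventually assms(1)) simp
  moreover have "\<forall>\<^sub>F n in sequentially. \<bar>a n - b\<bar> < min 1 (e / (2 * M))"
    using tendstoD[OF assms(2), of "min 1 (e / (2 * M))"] e M by (simp add: dist_real_def)
  ultimately show "\<forall>\<^sub>F n in sequentially. \<forall>x\<in>S n. \<bar>(a n *\<^sub>R F n) x - apply_bcontfun (b *\<^sub>R f) (\<iota> x)\<bar> \<le> e"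
  proof eventually_elim
    case (elim n)
    show ?case
    proof
      fix x assume x: "x \<in> S n"
      let ?y = "apply_bcontfun f (\<iota> x)"
      have "\<bar>a n\<bar> \<le> K"
        using elim(2) unfolding K_def by linarith
      then have "\<bar>a n\<bar> * \<bar>F n x - ?y\<bar> \<le> K * (e / (2 * K))"
        using elim(1) x K by (intro mult_mono) auto
      also have "\<dots> = e / 2"
        using K by simp
      finally have 1: "\<bar>a n * (F n x - ?y)\<bar> \<le> e / 2"
        by (simp add: abs_mult)
      have "\<bar>a n - b\<bar> * \<bar>?y\<bar> \<le> e / (2 * M) * M"
        using elim(2) e M M_def abs_apply_bcontfun_le[of f "\<iota> x"] by (intro mult_mono) auto
      also have "\<dots> = e / 2"
        using M by simp
      finally have 2: "\<bar>(a n - b) * ?y\<bar> \<le> e / 2"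
        by (simp add: abs_mult)
      have "(a n *\<^sub>R F n) x - apply_bcontfun (b *\<^sub>R f) (\<iota> x) = a n * (F n x - ?y) + (a n - b) * ?y"
        by (simp add: scaleR_fun_apply algebra_simps)
      then show "\<bar>(a n *\<^sub>R F n) x - apply_bcontfun (b *\<^sub>R f) (\<iota> x)\<bar> \<le> e"
        using 1 2 by linarith
    qed
  qed
qed

lemma conv_zero: "conv (\<lambda>n. 0) 0"
  by (simp add: conv_iff)

section \<open>Limits along a sequence of transition operators, one on each level\<close>

context
  fixes R :: "nat \<Rightarrow> ('a \<Rightarrow> real) \<Rightarrow> 'a \<Rightarrow> real"
  assumes R: "\<And>n. transition_operator (S n) (S n) (R n)"
begin

text \<open>Since \<open>F n\<close> and \<open>\<pi> n f\<close> are uniformly close, the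
  contraction \<open>R n\<close> keeps their images close. This allows computing with the
  restriction of \<open>h s\<close>, an exact eigenvector, in place of the projection of its
  limit.\<close>

lemma conv_operator_proj:
  assumes "conv F f" "\<And>n. F n \<in> CF (S n)" "conv (\<lambda>n. R n (F n)) g"
  shows "conv (\<lambda>n. R n (\<pi> n f)) g"
  unfolding conv_iff
proof safe
  fix e :: real assume "0 < e"
  then have "\<forall>\<^sub>F n in sequentially. \<forall>x\<in>S n. \<bar>F n x - apply_bcontfun f (\<iota> x)\<bar> \<le> e / 2"
    "\<forall>\<^sub>F n in sequentially. \<forall>x\<in>S n. \<bar>R n (F n) x - apply_bcontfun g (\<iota> x)\<bar> \<le> e / 2"
    by (intro conv_eventually assms; simp)+
  then show "\<forall>\<^sub>F n in sequentially. \<forall>x\<in>S n. \<bar>R n (\<pi> n f) x - apply_bcontfun g (\<iota> x)\<bar> \<le> e"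
  proof eventually_elim
    case (elim n)
    show ?case
    proof
      fix x assume x: "x \<in> S n"
      have "\<bar>R n (F n - \<pi> n f) x\<bar> \<le> e / 2"
      proof (rule transition_operator_contraction[OF R _ _ x])
        show "F n - \<pi> n f \<in> CF (S n)"
          by (intro subspace_diff[OF subspace_CF] assms(2) \<pi>_CF)
      qed (use elim in \<open>simp add: proj_apply\<close>)
      then have "\<bar>R n (F n) x - R n (\<pi> n f) x\<bar> \<le> e / 2"
        by (simp add: transition_operator_diff[OF R assms(2) \<pi>_CF])
      moreover have "\<bar>R n (F n) x - apply_bcontfun g (\<iota> x)\<bar> \<le> e / 2"
        using elim x by auto
      ultimately show "\<bar>R n (\<pi> n f) x - apply_bcontfun g (\<iota> x)\<bar> \<le> e"
        by linarith
    qed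
  qed
qed

lemma limit_norm_le:
  assumes "conv (\<lambda>n. R n (\<pi> n f)) g"
  shows "norm g \<le> norm f"
proof (rule norm_bound)
  fix x
  obtain s where s: "\<And>n. s n \<in> S n" "(\<lambda>n. \<iota> (s n)) \<longlonglongrightarrow> x"
    using dense_levels by blast
  have "\<bar>R n (\<pi> n f) (s n)\<bar> \<le> norm f" for n
    by (rule transition_operator_contraction[OF R \<pi>_CF _ s(1)])
       (simp add: proj_apply abs_apply_bcontfun_le)
  then show "norm (apply_bcontfun g x) \<le> norm f"
    by (intro tendsto_upperbound[OF tendsto_norm[OF conv_pointwise[OF assms s]]]) auto
qed

lemma limit_nonneg:
  assumes "conv (\<lambda>n. R n (\<pi> n f)) g" "\<And>x. 0 \<le> apply_bcontfun f x"
  shows "0 \<le> apply_bcontfun g x"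
proof -
  obtain s where s: "\<And>n. s n \<in> S n" "(\<lambda>n. \<iota> (s n)) \<longlonglongrightarrow> x"
    using dense_levels by blast
  have "0 \<le> R n (\<pi> n f) (s n)" for n
    by (rule transition_operator_nonneg[OF R \<pi>_CF]) (simp add: proj_apply assms(2))
  then show ?thesis
    by (intro tendsto_lowerbound[OF conv_pointwise[OF assms(1) s]]) auto
qed

lemma limit_one: "conv (\<lambda>n. R n (\<pi> n (const_bcontfun 1))) (const_bcontfun 1)"
proof -
  have "R n (\<pi> n (const_bcontfun 1)) = \<pi> n (const_bcontfun 1)" for n
    using transition_operator_one[OF R[of n]] by (simp add: proj_def const_bcontfun.rep_eq)
  then show ?thesis
    by (simp add: conv_iff proj_apply)
qed

lemma limit_add:
  assumes "conv (\<lambda>n. R n (\<pi> n f)) f'" "conv (\<lambda>n. R n (\<pi> n g)) g'"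
  shows "conv (\<lambda>n. R n (\<pi> n (f + g))) (f' + g')"
  using conv_add[OF assms] by (simp only: proj_add transition_operator_add[OF R \<pi>_CF \<pi>_CF])

lemma limit_scale:
  assumes "conv (\<lambda>n. R n (\<pi> n f)) f'"
  shows "conv (\<lambda>n. R n (\<pi> n (a *\<^sub>R f))) (a *\<^sub>R f')"
  using conv_scale[OF assms tendsto_const] by (simp only: proj_scale transition_operator_scale[OF R \<pi>_CF])

lemma limit_diff:
  assumes "conv (\<lambda>n. R n (\<pi> n f)) f'" "conv (\<lambda>n. R n (\<pi> n g)) g'"
  shows "conv (\<lambda>n. R n (\<pi> n (f - g))) (f' - g')"
  using limit_add[OF assms(1) limit_scale[OF assms(2), of "-1"]] by simp

text \<open>The limits \<open>g j\<close> are no further apart than the \<open>f j\<close>, so they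
  form a Cauchy sequence and converge to some \<open>g'\<close>. A three-term estimate, with
  \<open>j\<close> fixed before \<open>n\<close>, identifies \<open>g'\<close> as the limit
  belonging to \<open>l\<close>.\<close>

lemma closed_limit_exists: "closed {f. \<exists>g. conv (\<lambda>n. R n (\<pi> n f)) g}"
  unfolding closed_sequential_limits
proof safe
  fix f l assume "\<forall>j. f j \<in> {f. \<exists>g. conv (\<lambda>n. R n (\<pi> n f)) g}" and lim: "f \<longlonglongrightarrow> l"
  then obtain g where g: "\<And>j. conv (\<lambda>n. R n (\<pi> n (f j))) (g j)"
    by auto metis
  have le: "dist (g i) (g j) \<le> dist (f i) (f j)" for i j
    using limit_norm_le[OF limit_diff[OF g[of i] g[of j]]] by (simp add: dist_norm)
  have "Cauchy f"
    using lim LIMSEQ_imp_Cauchy by blast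
  then have "Cauchy g"
    unfolding Cauchy_def using le by (meson order_le_less_trans)
  then obtain g' where g': "g \<longlonglongrightarrow> g'"
    using Cauchy_convergent convergent_def by blast
  have "conv (\<lambda>n. R n (\<pi> n l)) g'"
    unfolding conv_iff
  proof safe
    fix e :: real assume e: "0 < e"
    have "\<forall>\<^sub>F j in sequentially. dist (f j) l < e / 3" "\<forall>\<^sub>F j in sequentially. dist (g j) g' < e / 3"
      using e by (intro tendstoD lim g'; simp)+
    then have "\<forall>\<^sub>F j in sequentially. dist (f j) l < e / 3 \<and> dist (g j) g' < e / 3"
      by (rule eventually_conj)
    then obtain j where j: "norm (f j - l) < e / 3" "norm (g j - g') < e / 3"
      using eventually_happens'[OF sequentially_bot] unfolding dist_norm by blast
    have "\<forall>\<^sub>F n in sequentially. \<forall>x\<in>S n. \<bar>R n (\<pi> n (f j)) x - apply_bcontfun (g j) (\<iota> x)\<bar> \<le> e / 3"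
      using e by (intro conv_eventually g) simp
    then show "\<forall>\<^sub>F n in sequentially. \<forall>x\<in>S n. \<bar>R n (\<pi> n l) x - apply_bcontfun g' (\<iota> x)\<bar> \<le> e"
    proof eventually_elim
      case (elim n)
      show ?case
      proof
        fix x assume x: "x \<in> S n"
        have "\<bar>R n (\<pi> n (f j) - \<pi> n l) x\<bar> \<le> norm (f j - l)"
        proof (rule transition_operator_contraction[OF R _ _ x])
          show "\<pi> n (f j) - \<pi> n l \<in> CF (S n)"
            by (intro subspace_diff[OF subspace_CF] \<pi>_CF)
          show "\<bar>(\<pi> n (f j) - \<pi> n l) y\<bar> \<le> norm (f j - l)" if "y \<in> S n" for y
            using abs_apply_bcontfun_le[of "f j - l" "\<iota> y"] that by (simp add: proj_apply)
        qed
        then have "\<bar>R n (\<pi> n (f j)) x - R n (\<pi> n l) x\<bar> \<le> e / 3"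
          using j(1) by (simp add: transition_operator_diff[OF R \<pi>_CF \<pi>_CF])
        moreover have "\<bar>apply_bcontfun (g j) (\<iota> x) - apply_bcontfun g' (\<iota> x)\<bar> \<le> e / 3"
          using abs_apply_bcontfun_le[of "g j - g'" "\<iota> x"] j(2) by simp
        moreover have "\<bar>R n (\<pi> n (f j)) x - apply_bcontfun (g j) (\<iota> x)\<bar> \<le> e / 3"
          using elim x by auto
        ultimately show "\<bar>R n (\<pi> n l) x - apply_bcontfun g' (\<iota> x)\<bar> \<le> e"
          by linarith
      qed
    qed
  qed
  then show "\<exists>g. conv (\<lambda>n. R n (\<pi> n l)) g" ..
qed

lemma limit_exists:
  assumes "closure (span B) = UNIV" "\<And>b. b \<in> B \<Longrightarrow> \<exists>g. conv (\<lambda>n. R n (\<pi> n b)) g"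
  shows "\<exists>!g. conv (\<lambda>n. R n (\<pi> n f)) g"
proof -
  let ?G = "{f. \<exists>g. conv (\<lambda>n. R n (\<pi> n f)) g}"
  have "subspace ?G"
  proof (rule subspaceI)
    show "0 \<in> ?G"
      using limit_scale[OF limit_one, of 0] by auto
  qed (use limit_add limit_scale in blast)+
  then have "span B \<subseteq> ?G"
    using assms(2) by (intro span_minimal) auto
  then have "closure (span B) \<subseteq> ?G"
    by (intro closure_minimal closed_limit_exists)
  then show ?thesis
    using assms(1) conv_unique by blast
qed

end

end

text \<open>With exponent \<open>m n\<close>, the product \<open>m n * \<epsilon> n\<close> tends to
  \<open>t\<close>, hence \<open>m n / c n\<close> tends to \<open>t\<close>, while
  \<open>c n * ln (1 - l / c n)\<close> tends to \<open>- l\<close>. The power is the exponential of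
  the product of these two sequences.\<close>

lemma power_floor_tendsto_exp:
  fixes c \<epsilon> :: "nat \<Rightarrow> real"
  assumes c: "filterlim c at_top sequentially"
    and eps: "\<And>n. 0 < \<epsilon> n" "\<epsilon> \<longlonglongrightarrow> 0" "(\<lambda>n. \<epsilon> n * c n) \<longlonglongrightarrow> 1" and t: "0 \<le> t"
  shows "(\<lambda>n. (1 - l / c n) ^ nat \<lfloor>t / \<epsilon> n\<rfloor>) \<longlonglongrightarrow> exp (- t * l)"
proof -
  define m where "m = (\<lambda>n. nat \<lfloor>t / \<epsilon> n\<rfloor>)"
  \<comment> \<open>Eventually \<open>1 - l / c n\<close> is positive, which the passage through the
    logarithm requires.\<close>
  have c_pos: "\<forall>\<^sub>F n in sequentially. \<bar>l\<bar> < c n"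
    using c by (simp add: filterlim_at_top_dense)
  have m_bounds: "t - \<epsilon> n \<le> real (m n) * \<epsilon> n" "real (m n) * \<epsilon> n \<le> t" for n
  proof -
    have "real (m n) = of_int \<lfloor>t / \<epsilon> n\<rfloor>"
      using t eps(1)[of n] by (simp add: m_def)
    then have "real (m n) \<le> t / \<epsilon> n" "t / \<epsilon> n - 1 \<le> real (m n)"
      by linarith+
    then show "t - \<epsilon> n \<le> real (m n) * \<epsilon> n" "real (m n) * \<epsilon> n \<le> t"
      using eps(1)[of n] by (simp_all add: field_simps)
  qed
  have "(\<lambda>n. real (m n) * \<epsilon> n) \<longlonglongrightarrow> t"
  proof (rule tendsto_sandwich)
    show "(\<lambda>n. t - \<epsilon> n) \<longlonglongrightarrow> t"
      using tendsto_diff[OF tendsto_const eps(2), of t] by simp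
  qed (use m_bounds in auto)
  then have "(\<lambda>n. real (m n) * \<epsilon> n / (\<epsilon> n * c n)) \<longlonglongrightarrow> t / 1"
    using eps(3) by (rule tendsto_divide) simp
  moreover have "real (m n) * \<epsilon> n / (\<epsilon> n * c n) = real (m n) / c n" for n
    using eps(1)[of n] by simp
  ultimately have m_c: "(\<lambda>n. real (m n) / c n) \<longlonglongrightarrow> t"
    by simp
  have "((\<lambda>x. x * ln (1 - l / x)) \<longlongrightarrow> - l) at_top"
    by real_asymp
  then have "(\<lambda>n. c n * ln (1 - l / c n)) \<longlonglongrightarrow> - l"
    using c by (rule filterlim_compose)
  from tendsto_mult[OF m_c this]
  have "(\<lambda>n. exp (real (m n) / c n * (c n * ln (1 - l / c n)))) \<longlonglongrightarrow> exp (t * - l)"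
    by (rule tendsto_exp)
  moreover have "\<forall>\<^sub>F n in sequentially.
      exp (real (m n) / c n * (c n * ln (1 - l / c n))) = (1 - l / c n) ^ m n"
    using c_pos
  proof eventually_elim
    case (elim n)
    then have "0 < 1 - l / c n"
      by (simp add: field_simps abs_less_iff)
    then have "exp (real (m n) * ln (1 - l / c n)) = (1 - l / c n) ^ m n"
      by (simp add: exp_of_nat_mult)
    moreover have "real (m n) / c n * (c n * ln (1 - l / c n)) = real (m n) * ln (1 - l / c n)"
      using elim by auto
    ultimately show ?case
      by simp
  qed
  ultimately have "(\<lambda>n. (1 - l / c n) ^ m n) \<longlonglongrightarrow> exp (t * - l)"
    by (rule Lim_transform_eventually)
  then show ?thesis
    by (simp add: m_def)
qed

subsection \<open>The scaling limit\<close>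

locale scaling_limit = up_down_system S c T D + dense_levels S \<iota>
  for S :: "nat \<Rightarrow> 'a set" and c :: "nat \<Rightarrow> real"
    and T D :: "nat \<Rightarrow> ('a \<Rightarrow> real) \<Rightarrow> 'a \<Rightarrow> real"
    and \<iota> :: "'a \<Rightarrow> 'e::metric_space" +
  fixes d\<^sub>o :: "'a \<Rightarrow> 'e \<Rightarrow>\<^sub>C real" and \<epsilon> :: "nat \<Rightarrow> real"
  assumes d\<^sub>o_dense: "closure (span (d\<^sub>o ` states S)) = UNIV"
    and d\<^sub>o_limit: "s \<in> states S \<Longrightarrow> conv_to S \<iota> (\<lambda>n. restr (S n) (d_fun S D s)) (d\<^sub>o s)"
    and c_at_top: "filterlim c at_top sequentially"
    and \<epsilon>_pos: "0 < \<epsilon> n"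
    and \<epsilon>_tendsto: "\<epsilon> \<longlonglongrightarrow> 0"
    and \<epsilon>_c: "(\<lambda>n. \<epsilon> n * c n) \<longlonglongrightarrow> 1"
begin

abbreviation "lift \<equiv> lift_o S D d\<^sub>o"
abbreviation "h\<^sub>o \<equiv> \<lambda>s. lift (h s)"
abbreviation "rate \<equiv> \<lambda>s. cpred c (level S s)"
abbreviation "\<T> \<equiv> limit_op S T \<iota> \<epsilon>"
abbreviation "R \<equiv> \<lambda>t n. T n ^^ nat \<lfloor>t / \<epsilon> n\<rfloor>"

lemma lift_linear: "linear lift" and lift_d: "s \<in> states S \<Longrightarrow> lift (d s) = d\<^sub>o s"
  using someI_ex[OF d_extension[of d\<^sub>o]] unfolding lift_o_def by auto

lemma Q_linear: "linear (Q_op S c T D t)"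
  and Q_h: "s \<in> states S \<Longrightarrow> Q_op S c T D t (h s) = exp (- t * rate s) *\<^sub>R h s"
  using someI_ex[OF h_extension[of "\<lambda>s. exp (- t * rate s) *\<^sub>R h s"]] unfolding Q_op_def by auto

lemma H_space_eq: "H_space S D = span (h ` states S)"
  by (simp add: H_space_def span_h)

text \<open>The linear image of \<open>span_h\<close>. It transfers the density (L2) to the
  eigenvectors and later rewrites the core as the span of the \<open>d\<^sub>o s\<close>.\<close>

lemma span_h\<^sub>o: "span (h\<^sub>o ` states S) = span (d\<^sub>o ` states S)"
proof -
  have "span (h\<^sub>o ` states S) = lift ` span (h ` states S)"
    using linear_span_image[OF lift_linear, of "h ` states S"] by (simp only: image_image)
  also have "\<dots> = span (lift ` (d ` states S))"
    by (simp only: span_h linear_span_image[OF lift_linear])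
  also have "lift ` (d ` states S) = d\<^sub>o ` states S"
    unfolding image_image by (intro image_cong lift_d refl)
  finally show ?thesis .
qed

text \<open>Linearity extends (L3) from the \<open>d s\<close> to all of \<open>H\<close>, in
  particular to the \<open>h s\<close>.\<close>

lemma conv_lift:
  assumes "f \<in> H_space S D"
  shows "conv (\<lambda>n. restr (S n) f) (lift f)"
proof -
  have "subspace {f. conv (\<lambda>n. restr (S n) f) (lift f)}"
  proof (rule subspaceI; clarify)
    show "conv (\<lambda>n. restr (S n) 0) (lift 0)"
      by (simp only: linear_0[OF linear_restr] linear_0[OF lift_linear] conv_zero)
  next
    fix f g assume "conv (\<lambda>n. restr (S n) f) (lift f)" "conv (\<lambda>n. restr (S n) g) (lift g)"
    from conv_add[OF this] show "conv (\<lambda>n. restr (S n) (f + g)) (lift (f + g))"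
      by (simp only: linear_add[OF linear_restr] linear_add[OF lift_linear])
  next
    fix a f assume "conv (\<lambda>n. restr (S n) f) (lift f)"
    from conv_scale[OF this tendsto_const] show "conv (\<lambda>n. restr (S n) (a *\<^sub>R f)) (lift (a *\<^sub>R f))"
      by (simp only: linear_scale[OF linear_restr] linear_scale[OF lift_linear])
  qed
  moreover have "d ` states S \<subseteq> {f. conv (\<lambda>n. restr (S n) f) (lift f)}"
    using d\<^sub>o_limit by (auto simp: lift_d)
  ultimately show ?thesis
    using span_minimal assms unfolding H_space_def by blast
qed

lemma h_in_H: "s \<in> states S \<Longrightarrow> h s \<in> H_space S D"
  unfolding H_space_eq by (intro span_base imageI)

lemma eventually_level_le: "\<forall>\<^sub>F n in sequentially. level S s \<le> n"
  by (rule eventually_ge_at_top)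

lemma R_transition: "transition_operator (S n) (S n) (R t n)"
  by (rule transition_operator_funpow[OF finite_levels T_transition])

text \<open>From level \<open>|s|\<close> on, \<open>R t n\<close> acts on the restriction of
  \<open>h s\<close> as a scalar, so only a numerical limit and \<open>conv_lift\<close> are
  involved.\<close>

lemma conv_R_h:
  assumes "0 \<le> t" "s \<in> states S"
  shows "conv (\<lambda>n. R t n (restr (S n) (h s))) (exp (- t * rate s) *\<^sub>R h\<^sub>o s)"
proof (rule conv_cong)
  show "conv (\<lambda>n. (1 - rate s / c n) ^ nat \<lfloor>t / \<epsilon> n\<rfloor> *\<^sub>R restr (S n) (h s)) (exp (- t * rate s) *\<^sub>R h\<^sub>o s)"
    by (intro conv_scale conv_lift h_in_H assms
        power_floor_tendsto_exp[OF c_at_top \<epsilon>_pos \<epsilon>_tendsto \<epsilon>_c])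
  show "\<forall>\<^sub>F n in sequentially. R t n (restr (S n) (h s)) =
      (1 - rate s / c n) ^ nat \<lfloor>t / \<epsilon> n\<rfloor> *\<^sub>R restr (S n) (h s)"
    using eventually_level_le[of s]
    by eventually_elim (rule T_funpow_h[OF assms(2)[unfolded states_iff]])
qed

lemma conv_R_h\<^sub>o:
  assumes "0 \<le> t" "s \<in> states S"
  shows "conv (\<lambda>n. R t n (\<pi> n (h\<^sub>o s))) (exp (- t * rate s) *\<^sub>R h\<^sub>o s)"
  by (rule conv_operator_proj[OF R_transition conv_lift[OF h_in_H[OF assms(2)]] restr_CF conv_R_h[OF assms]])

lemma h\<^sub>o_dense: "closure (span (h\<^sub>o ` states S)) = UNIV"
  by (simp only: span_h\<^sub>o d\<^sub>o_dense)

lemma ex1_limit: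
  assumes "0 \<le> t"
  shows "\<exists>!g. conv (\<lambda>n. R t n (\<pi> n f)) g"
  using conv_R_h\<^sub>o[OF assms] by (intro limit_exists[OF R_transition h\<^sub>o_dense]) blast

lemma conv_\<T>: "0 \<le> t \<Longrightarrow> conv (\<lambda>n. R t n (\<pi> n f)) (\<T> t f)"
  unfolding limit_op_def by (rule theI'[OF ex1_limit])

text \<open>\<open>limit_op\<close> is a definite description, so an identity for
  \<open>\<T>\<close> is proved by exhibiting a limit.\<close>

lemma \<T>_eqI: "0 \<le> t \<Longrightarrow> conv (\<lambda>n. R t n (\<pi> n f)) g \<Longrightarrow> \<T> t f = g"
  using conv_unique conv_\<T> by blast

lemma \<T>_linear: "0 \<le> t \<Longrightarrow> linear (\<T> t)"
  by (intro linearI \<T>_eqI limit_add[OF R_transition] limit_scale[OF R_transition] conv_\<T>)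

sublocale eigen_contractions \<T> "states S" h\<^sub>o rate
proof (rule eigen_contractions.intro)
  show "linear (\<T> t)" if "0 \<le> t" for t
    using that by (rule \<T>_linear)
  show "norm (\<T> t f) \<le> norm f" if "0 \<le> t" for t f
    using that by (intro limit_norm_le[OF R_transition conv_\<T>])
  show "\<T> t (h\<^sub>o s) = exp (- t * rate s) *\<^sub>R h\<^sub>o s" if "0 \<le> t" "s \<in> states S" for t s
    using that by (intro \<T>_eqI conv_R_h\<^sub>o)
qed (simp_all only: cpred_nonneg h\<^sub>o_dense)

lemma feller: "feller_semigroup \<T>"
  unfolding feller_semigroup_def
proof (intro conjI allI impI)
  show "\<T> 0 = id"
    by (rule P_zero)
  show "\<T> (s + t) = \<T> s \<circ> \<T> t" if "0 \<le> s" "0 \<le> t" for s t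
    using that by (rule P_add)
  show "linear (\<T> t)" if "0 \<le> t" for t
    using that by (rule \<T>_linear)
  show "0 \<le> apply_bcontfun (\<T> t f) x" if "0 \<le> t" "\<forall>x. 0 \<le> apply_bcontfun f x" for t f x
    using that by (intro limit_nonneg[OF R_transition conv_\<T>]) auto
  show "norm (\<T> t f) \<le> norm f" if "0 \<le> t" for t f
    using that by (rule P_contraction)
  show "\<T> t (const_bcontfun 1) = const_bcontfun 1" if "0 \<le> t" for t
    using that by (intro \<T>_eqI limit_one[OF R_transition])
  show "((\<lambda>t. apply_bcontfun (\<T> t f) x) \<longlongrightarrow> apply_bcontfun f x) (at_right 0)" for f x
  \<comment> \<open>The pointwise continuity in the Feller property is dominated by strong
    continuity in norm.\<close>
  proof (rule Lim_null_comparison[THEN LIM_zero_cancel])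
    show "((\<lambda>t. norm (\<T> t f - f)) \<longlongrightarrow> 0) (at_right 0)"
      using P_strongly_continuous by (intro tendsto_norm_zero LIM_zero)
    show "\<forall>\<^sub>F t in at_right 0. norm (apply_bcontfun (\<T> t f) x - apply_bcontfun f x) \<le> norm (\<T> t f - f)"
      using abs_apply_bcontfun_le[of "\<T> t f - f" x for t] by simp
  qed
qed

text \<open>Both sides are linear in \<open>f\<close> and multiply the lift of each
  \<open>h s\<close> by the same exponential.\<close>

lemma \<T>_lift:
  assumes "0 \<le> t" "f \<in> H_space S D"
  shows "\<T> t (lift f) = lift (Q_op S c T D t f)"
proof -
  have "(\<T> t \<circ> lift) f = (lift \<circ> Q_op S c T D t) f"
  proof (rule linear_eq_on_span[where B = "h ` states S"])
    show "linear (\<T> t \<circ> lift)"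
      by (rule linear_compose[OF lift_linear \<T>_linear[OF assms(1)]])
    show "linear (lift \<circ> Q_op S c T D t)"
      by (rule linear_compose[OF Q_linear lift_linear])
    show "(\<T> t \<circ> lift) x = (lift \<circ> Q_op S c T D t) x" if x: "x \<in> h ` states S" for x
    proof -
      obtain s where s: "s \<in> states S" "x = h s"
        using x by blast
      show ?thesis
        by (simp only: s comp_apply Q_h[OF s(1)] P_eigen[OF assms(1) s(1)] linear_scale[OF lift_linear])
    qed
  qed (use assms(2) in \<open>simp only: H_space_eq\<close>)
  then show ?thesis
    by (simp only: comp_apply)
qed

lemma conv_A:
  assumes "f \<in> H_space S D"
  shows "conv (\<lambda>n. A n (restr (S n) f)) (gen \<T> (lift f))"
proof -
  \<comment> \<open>Membership in the span is carried along because \<open>gen\<close> respects sums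
    and multiples only on its domain.\<close>
  let ?V = "{f \<in> span (h ` states S). conv (\<lambda>n. A n (restr (S n) f)) (gen \<T> (lift f))}"
  have dom: "lift f \<in> gen_domain \<T>" if "f \<in> span (h ` states S)" for f
    using that linear_span_image[OF lift_linear, of "h ` states S"]
    by (intro span_gen(1)) (auto simp only: image_image)
  have "subspace ?V"
  proof (rule subspaceI; clarify; intro conjI)
    show "conv (\<lambda>n. A n (restr (S n) 0)) (gen \<T> (lift 0))"
      using gen_scale[OF dom[OF span_zero], of 0]
      by (simp only: linear_0[OF A_linear] linear_0[OF lift_linear] scaleR_zero_left conv_zero)
  next
    fix f g assume fg: "f \<in> span (h ` states S)" "g \<in> span (h ` states S)"
      and "conv (\<lambda>n. A n (restr (S n) f)) (gen \<T> (lift f))" "conv (\<lambda>n. A n (restr (S n) g)) (gen \<T> (lift g))"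
    from conv_add[OF this(3,4)] show "conv (\<lambda>n. A n (restr (S n) (f + g))) (gen \<T> (lift (f + g)))"
      by (simp only: linear_add[OF A_linear] linear_add[OF lift_linear] gen_add[OF dom[OF fg(1)] dom[OF fg(2)]])
  next
    fix a f assume f: "f \<in> span (h ` states S)" and "conv (\<lambda>n. A n (restr (S n) f)) (gen \<T> (lift f))"
    from conv_scale[OF this(2) tendsto_const] show "conv (\<lambda>n. A n (restr (S n) (a *\<^sub>R f))) (gen \<T> (lift (a *\<^sub>R f)))"
      by (simp only: linear_scale[OF A_linear] linear_scale[OF lift_linear] gen_scale[OF dom[OF f]])
  qed (simp_all only: span_zero span_add span_scale)
  \<comment> \<open>For \<open>h s\<close> the eigenvalue equation is exact from level
    \<open>|s|\<close> on, with the eigenvalue that \<open>gen_eigen\<close> gives for the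
    limit.\<close>
  moreover have "conv (\<lambda>n. A n (restr (S n) (h s))) (gen \<T> (h\<^sub>o s))" if s: "s \<in> states S" for s
  proof (rule conv_cong)
    show "conv (\<lambda>n. - rate s *\<^sub>R restr (S n) (h s)) (gen \<T> (h\<^sub>o s))"
      unfolding gen_eigen[OF s] by (intro conv_scale conv_lift h_in_H s tendsto_const)
    show "\<forall>\<^sub>F n in sequentially. A n (restr (S n) (h s)) = - rate s *\<^sub>R restr (S n) (h s)"
      using eventually_level_le[of s] by eventually_elim (rule A_h[OF s[unfolded states_iff]])
  qed
  then have "h ` states S \<subseteq> ?V"
    by (auto intro: span_base)
  ultimately show ?thesis
    using span_minimal[of "h ` states S" ?V] assms unfolding H_space_eq by blast
qed

end

theorem proposition4p3:
  fixes S :: "nat \<Rightarrow> 'a set"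
    and c :: "nat \<Rightarrow> real"
    and T D :: "nat \<Rightarrow> ('a \<Rightarrow> real) \<Rightarrow> 'a \<Rightarrow> real"
    and \<iota> :: "'a \<Rightarrow> 'e::metric_space"
    and d\<^sub>o :: "'a \<Rightarrow> 'e \<Rightarrow>\<^sub>C real"
    and \<epsilon> :: "nat \<Rightarrow> real"
  defines "A \<equiv> chain_gen c T"
    and "h\<^sub>o \<equiv> \<lambda>s. lift_o S D d\<^sub>o (h_fun S c T D s)"
    and "\<T> \<equiv> limit_op S T \<iota> \<epsilon>"
  assumes A0_finite: "\<And>n. finite (S n)"
    and A0_disjoint: "\<And>m n. m \<noteq> n \<Longrightarrow> S m \<inter> S n = {}"
    and A0_root: "\<exists>r. S 0 = {r}"
    and A0_T: "\<And>n. transition_operator (S n) (S n) (T n)"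
    and A1: "\<And>n. 0 < c n \<and> c n < c (Suc n)"
    and A2: "\<And>n. transition_operator (S n) (S (Suc n)) (D (Suc n))"
    and A3: "\<And>n. (\<lambda>f. A (Suc n) f + c n *\<^sub>R f) ` CF (S (Suc n)) \<subseteq> D (Suc n) ` CF (S n)"
    and A4: "\<And>n. inj_on (D (Suc n)) (CF (S n))"
    and A5: "\<And>n f. f \<in> CF (S n) \<Longrightarrow> A (Suc n) (D (Suc n) f) = D (Suc n) (A n f)"
    and E_compact: "compact (UNIV :: 'e set)"
    and L1: "\<And>x. \<exists>s. (\<forall>n. s n \<in> S n) \<and> (\<lambda>n. \<iota> (s n)) \<longlonglongrightarrow> x"
    and L2: "closure (span (d\<^sub>o ` states S)) = UNIV"
    and L3: "\<And>s. s \<in> states S \<Longrightarrow> conv_to S \<iota> (\<lambda>n. restr (S n) (d_fun S D s)) (d\<^sub>o s)"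
    and c_inf: "filterlim c at_top sequentially"
    and eps_pos: "\<And>n. 0 < \<epsilon> n"
    and eps_0: "\<epsilon> \<longlonglongrightarrow> 0"
    and eps_c: "(\<lambda>n. \<epsilon> n * c n) \<longlonglongrightarrow> 1"
  shows
    "((\<forall>f. \<forall>t\<ge>0. \<exists>!g. conv_to S \<iota> (\<lambda>n. (T n ^^ nat \<lfloor>t / \<epsilon> n\<rfloor>) (proj S \<iota> n f)) g) \<and>
      (\<forall>f. \<forall>t\<ge>0. conv_to S \<iota> (\<lambda>n. (T n ^^ nat \<lfloor>t / \<epsilon> n\<rfloor>) (proj S \<iota> n f)) (\<T> t f)) \<and>
      (\<forall>t\<ge>0. linear (\<T> t)))
    \<and> ((\<forall>f\<in>H_space S D. \<forall>t\<ge>0. \<T> t (lift_o S D d\<^sub>o f) = lift_o S D d\<^sub>o (Q_op S c T D t f)) \<and>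
      (\<forall>s\<in>states S. \<forall>t\<ge>0. \<T> t (h\<^sub>o s) = exp (- t * cpred c (level S s)) *\<^sub>R h\<^sub>o s))
    \<and> feller_semigroup \<T>
    \<and> (is_core \<T> (span (d\<^sub>o ` states S)) \<and>
      (\<forall>s\<in>states S. gen \<T> (h\<^sub>o s) = - cpred c (level S s) *\<^sub>R h\<^sub>o s))
    \<and> (\<forall>f\<in>H_space S D.
        conv_to S \<iota> (\<lambda>n. A n (restr (S n) f)) (gen \<T> (lift_o S D d\<^sub>o f)))"
proof -
  have "up_down_system S c T D"
    by (rule up_down_system.intro)
       (assumption | rule A0_finite A0_disjoint A0_root A0_T A1[THEN conjunct1] A1[THEN conjunct2] A2
          A3[unfolded A_def] A4 A5[unfolded A_def])+
  moreover have "dense_levels S \<iota>"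
    by (rule dense_levels.intro) (rule A0_finite L1)+
  moreover have "scaling_limit_axioms S c D \<iota> d\<^sub>o \<epsilon>"
    by (rule scaling_limit_axioms.intro) (assumption | rule L2 L3 c_inf eps_pos eps_0 eps_c)+
  ultimately interpret L: scaling_limit S c T D \<iota> d\<^sub>o \<epsilon>
    by (rule scaling_limit.intro)
  show ?thesis
    unfolding A_def h\<^sub>o_def \<T>_def
    by (intro conjI ballI allI impI;
        rule L.ex1_limit L.conv_\<T> L.\<T>_linear L.\<T>_lift L.P_eigen L.feller
          L.span_is_core[unfolded L.span_h\<^sub>o] L.gen_eigen L.conv_A; assumption)
qed

end
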